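(* Let $A$ be a semisimple MV-algebra, with maximal spectral space $\mu(A)$. (i) If $\mu(A)$ is an $n$-dimensional manifold without boundary, then $A$ is hopfian. (ii) If $\mu(A)$ is an $n$-manifold with boundary and $A$ has a generating set with $n$ elements, then $A$ is hopfian. (iii) More generally, $A$ is hopfian if $A$ has a generating set of $n$ elements and $\mu(A)$ is homeomorphically embeddable onto a subset $X$ of $[0,1]^n$ coinciding with the closure of its interior.
   Context: An MV-algebra is an abelian monoid $(A,0,\oplus)$ with a unary operation $\neg$ satisfying $\neg\neg x=x$, $x\oplus\neg 0=\neg 0$ and $\neg(\neg x\oplus y)\oplus y=\neg(\neg y\oplus x)\oplus x$. All MV-algebras are assumed nontrivial. An ideal is the kernel $h^{-1}(0)$ of a homomorphism $h$; ideals are assumed proper. $\mu(A)$ is the set of maximal ideals of $A$ with the hull-kernel topology: a basis of closed sets is given by the sets $\{\mathfrak m\in\mu(A)\mid a\in\mathfrak m\}$, $a\in A$; it is a nonempty compact Hausdorff space. $A$ is semisimple if the intersection of its maximal ideals is $\{0\}$. Manifolds are topological manifolds. $A$ is hopfian if every homomorphism of $A$ onto $A$ is an automorphism. *)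

theory Defs
  imports "HOL-Analysis.Analysis" "HOL-Algebra.Group"
begin

section \<open>MV-algebras\<close>

record 'a mv_algebra = "'a partial_object" +
  mv_plus :: "['a, 'a] \<Rightarrow> 'a" (infixl \<open>\<oplus>\<index>\<close> 65)
  mv_zero :: 'a (\<open>\<zero>\<index>\<close>)
  mv_neg :: "'a \<Rightarrow> 'a" (\<open>\<sim>\<index> _\<close> [81] 80)

locale mv_algebra =
  fixes A :: "('a, 'm) mv_algebra_scheme" (structure)
  assumes plus_comm_monoid:
      "comm_monoid \<lparr>carrier = carrier A, mult = mv_plus A, one = \<zero>\<rparr>"
    and neg_closed: "x \<in> carrier A \<Longrightarrow> \<sim> x \<in> carrier A"
    and neg_neg: "x \<in> carrier A \<Longrightarrow> \<sim> (\<sim> x) = x"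
    and plus_neg_zero: "x \<in> carrier A \<Longrightarrow> x \<oplus> \<sim> \<zero> = \<sim> \<zero>"
    and lukasiewicz: "\<lbrakk>x \<in> carrier A; y \<in> carrier A\<rbrakk>
      \<Longrightarrow> \<sim> (\<sim> x \<oplus> y) \<oplus> y = \<sim> (\<sim> y \<oplus> x) \<oplus> x"
    and nontrivial: "carrier A \<noteq> {\<zero>}"

definition mv_hom ::
    "('a, 'm) mv_algebra_scheme \<Rightarrow> ('b, 'k) mv_algebra_scheme \<Rightarrow> ('a \<Rightarrow> 'b) set" where
  "mv_hom A B = {h \<in> carrier A \<rightarrow> carrier B.
     h \<zero>\<^bsub>A\<^esub> = \<zero>\<^bsub>B\<^esub> \<and>
     (\<forall>x\<in>carrier A. \<forall>y\<in>carrier A. h (x \<oplus>\<^bsub>A\<^esub> y) = h x \<oplus>\<^bsub>B\<^esub> h y) \<and>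
     (\<forall>x\<in>carrier A. h (\<sim>\<^bsub>A\<^esub> x) = \<sim>\<^bsub>B\<^esub> (h x))}"

definition mv_iso ::
    "('a, 'm) mv_algebra_scheme \<Rightarrow> ('b, 'k) mv_algebra_scheme \<Rightarrow> ('a \<Rightarrow> 'b) set" where
  "mv_iso A B = {h \<in> mv_hom A B. bij_betw h (carrier A) (carrier B)}"

definition mv_kernel ::
    "('a, 'm) mv_algebra_scheme \<Rightarrow> ('b, 'k) mv_algebra_scheme \<Rightarrow> ('a \<Rightarrow> 'b) \<Rightarrow> 'a set" where
  "mv_kernel A B h = {x \<in> carrier A. h x = \<zero>\<^bsub>B\<^esub>}"

definition hopfian :: "('a, 'm) mv_algebra_scheme \<Rightarrow> bool" where
  "hopfian A \<longleftrightarrow> (\<forall>h\<in>mv_hom A A. h ` carrier A = carrier A \<longrightarrow> h \<in> mv_iso A A)"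

inductive_set mv_generate :: "('a, 'm) mv_algebra_scheme \<Rightarrow> 'a set \<Rightarrow> 'a set"
  for A (structure) and S where
    zero: "\<zero> \<in> mv_generate A S"
  | incl: "x \<in> S \<Longrightarrow> x \<in> mv_generate A S"
  | plus: "x \<in> mv_generate A S \<Longrightarrow> y \<in> mv_generate A S \<Longrightarrow> x \<oplus> y \<in> mv_generate A S"
  | neg: "x \<in> mv_generate A S \<Longrightarrow> \<sim> x \<in> mv_generate A S"

definition has_generating_set_of_size :: "('a, 'm) mv_algebra_scheme \<Rightarrow> nat \<Rightarrow> bool" where
  "has_generating_set_of_size A n \<longleftrightarrow>
     (\<exists>S\<subseteq>carrier A. finite S \<and> card S = n \<and> mv_generate A S = carrier A)"

text \<open>
  An ideal is the kernel of a homomorphism. A type cannot be quantified inside a definition, so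
  the codomains range over the MV-algebras on \<^typ>\<open>'a set\<close>, where the quotients of \<open>A\<close> live;
  \<open>mv_ideal_kernel\<close> below shows that codomains over other types give no further ideals.
  Codomains are nontrivial, so ideals are proper (\<open>mv_ideal_proper\<close>).
\<close>
definition mv_ideal :: "('a, 'm) mv_algebra_scheme \<Rightarrow> 'a set \<Rightarrow> bool" where
  "mv_ideal A I \<longleftrightarrow>
     (\<exists>(B :: 'a set mv_algebra) h. mv_algebra B \<and> h \<in> mv_hom A B \<and> I = mv_kernel A B h)"

definition max_ideals :: "('a, 'm) mv_algebra_scheme \<Rightarrow> 'a set set" where
  "max_ideals A = {M. mv_ideal A M \<and> (\<forall>I. mv_ideal A I \<and> M \<subseteq> I \<longrightarrow> I = M)}"

definition semisimple :: "('a, 'm) mv_algebra_scheme \<Rightarrow> bool" where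
  "semisimple A \<longleftrightarrow> \<Inter> (max_ideals A) = {\<zero>\<^bsub>A\<^esub>}"

text \<open>
  The sets \<open>{M \<in> max_ideals A. a \<in> M}\<close> are a basis of closed sets of the hull-kernel topology,
  so their complements are an open basis and in particular generate the topology.
\<close>
definition max_spectrum :: "('a, 'm) mv_algebra_scheme \<Rightarrow> 'a set topology" where
  "max_spectrum A = topology_generated_by
     {max_ideals A - {M \<in> max_ideals A. a \<in> M} | a. a \<in> carrier A}"


section \<open>Topological manifolds\<close>

definition locally_homeomorphic_to :: "'a topology \<Rightarrow> 'b topology \<Rightarrow> bool" where
  "locally_homeomorphic_to X H \<longleftrightarrow>
     (\<forall>x\<in>topspace X. \<exists>U V. openin X U \<and> x \<in> U \<and> openin H V \<and>
        subtopology X U homeomorphic_space subtopology H V)"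

definition manifold_without_boundary :: "nat \<Rightarrow> 'a topology \<Rightarrow> bool" where
  "manifold_without_boundary n X \<longleftrightarrow>
     Hausdorff_space X \<and> second_countable X \<and> locally_homeomorphic_to X (Euclidean_space n)"

text \<open>Coordinates are indexed by \<open>0, \<dots>, n - 1\<close>; for \<open>n = 0\<close> the half-space is a point.\<close>
definition half_space :: "nat \<Rightarrow> (nat \<Rightarrow> real) topology" where
  "half_space n = subtopology (Euclidean_space n) {x. 0 \<le> x (n - 1)}"

text \<open>As usual, the boundary is allowed to be empty.\<close>
definition manifold_with_boundary :: "nat \<Rightarrow> 'a topology \<Rightarrow> bool" where
  "manifold_with_boundary n X \<longleftrightarrow>
     Hausdorff_space X \<and> second_countable X \<and> locally_homeomorphic_to X (half_space n)"

definition unit_cube :: "nat \<Rightarrow> (nat \<Rightarrow> real) set" where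
  "unit_cube n = {x \<in> topspace (Euclidean_space n). \<forall>i<n. 0 \<le> x i \<and> x i \<le> 1}"


section \<open>Sanity checks\<close>

context mv_algebra
begin

lemma zero_closed: "\<zero> \<in> carrier A"
  using monoid.one_closed[OF comm_monoid.axioms(1)[OF plus_comm_monoid]] by simp

lemma plus_closed: "x \<in> carrier A \<Longrightarrow> y \<in> carrier A \<Longrightarrow> x \<oplus> y \<in> carrier A"
  using monoid.m_closed[OF comm_monoid.axioms(1)[OF plus_comm_monoid]] by simp

lemma zero_plus: "x \<in> carrier A \<Longrightarrow> \<zero> \<oplus> x = x"
  using monoid.l_one[OF comm_monoid.axioms(1)[OF plus_comm_monoid]] by simp

lemma plus_assoc: "x \<in> carrier A \<Longrightarrow> y \<in> carrier A \<Longrightarrow> z \<in> carrier A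
    \<Longrightarrow> x \<oplus> y \<oplus> z = x \<oplus> (y \<oplus> z)"
  using monoid.m_assoc[OF comm_monoid.axioms(1)[OF plus_comm_monoid]] by simp

lemma plus_comm: "x \<in> carrier A \<Longrightarrow> y \<in> carrier A \<Longrightarrow> x \<oplus> y = y \<oplus> x"
  using comm_monoid.m_comm[OF plus_comm_monoid] by simp

lemma neg_zero_neq: "\<sim> \<zero> \<noteq> \<zero>"
proof
  assume eq: "\<sim> \<zero> = \<zero>"
  have "x = \<zero>" if "x \<in> carrier A" for x
    using plus_neg_zero[OF that] zero_plus[OF that] plus_comm[OF that zero_closed] eq by simp
  then show False using nontrivial zero_closed by blast
qed

end

lemma mv_ideal_neg_zero:
  assumes "mv_algebra A" "mv_ideal A I"
  shows "\<sim>\<^bsub>A\<^esub> \<zero>\<^bsub>A\<^esub> \<notin> I"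
proof -
  interpret A: mv_algebra A by fact
  obtain B :: "'a set mv_algebra" and h
    where B: "mv_algebra B" and h: "h \<in> mv_hom A B" and I: "I = mv_kernel A B h"
    using assms(2) unfolding mv_ideal_def by blast
  have "h (\<sim>\<^bsub>A\<^esub> \<zero>\<^bsub>A\<^esub>) = \<sim>\<^bsub>B\<^esub> \<zero>\<^bsub>B\<^esub>"
    using h A.zero_closed by (simp add: mv_hom_def)
  then show ?thesis
    using mv_algebra.neg_zero_neq[OF B] by (simp add: I mv_kernel_def)
qed

lemma mv_ideal_proper:
  assumes "mv_algebra A" "mv_ideal A I"
  shows "I \<subset> carrier A"
proof -
  interpret A: mv_algebra A by fact
  have "\<sim>\<^bsub>A\<^esub> \<zero>\<^bsub>A\<^esub> \<in> carrier A" using A.zero_closed A.neg_closed by blast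
  moreover have "I \<subseteq> carrier A"
    using assms(2) by (auto simp: mv_ideal_def mv_kernel_def)
  ultimately show ?thesis using mv_ideal_neg_zero[OF assms] by blast
qed

lemma mv_ideal_kernel:
  fixes A :: "('a, 'm) mv_algebra_scheme" and B :: "('b, 'k) mv_algebra_scheme"
  assumes "mv_algebra A" "mv_algebra B" and h: "h \<in> mv_hom A B"
  shows "mv_ideal A (mv_kernel A B h)"
proof -
  interpret A: mv_algebra A by fact
  interpret B: mv_algebra B by fact
  define q where "q y = {x \<in> carrier A. h x = y}" for y
  define r where "r X = h (SOME x. x \<in> X)" for X
  define C where "C = \<lparr>carrier = q ` h ` carrier A,
    mv_plus = (\<lambda>X Y. q (r X \<oplus>\<^bsub>B\<^esub> r Y)), mv_zero = q \<zero>\<^bsub>B\<^esub>, mv_neg = (\<lambda>X. q (\<sim>\<^bsub>B\<^esub> (r X)))\<rparr>"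
  have hc: "h x \<in> carrier B" if "x \<in> carrier A" for x
    using h that by (auto simp: mv_hom_def)
  have h0: "h \<zero>\<^bsub>A\<^esub> = \<zero>\<^bsub>B\<^esub>"
    and hp: "\<And>x y. x \<in> carrier A \<Longrightarrow> y \<in> carrier A \<Longrightarrow> h x \<oplus>\<^bsub>B\<^esub> h y = h (x \<oplus>\<^bsub>A\<^esub> y)"
    and hn: "\<And>x. x \<in> carrier A \<Longrightarrow> \<sim>\<^bsub>B\<^esub> (h x) = h (\<sim>\<^bsub>A\<^esub> x)"
    using h by (auto simp: mv_hom_def)
  have rq: "r (q (h x)) = h x" if "x \<in> carrier A" for x
    unfolding r_def q_def by (rule someI2[where a = x]) (use that in auto)
  have qeq: "q (h x) = q (h y) \<longleftrightarrow> h x = h y" if "x \<in> carrier A" "y \<in> carrier A" for x y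
    using rq[OF that(1)] rq[OF that(2)] by metis
  have ops: "\<zero>\<^bsub>C\<^esub> = q (h \<zero>\<^bsub>A\<^esub>)"
    "\<And>x y. x \<in> carrier A \<Longrightarrow> y \<in> carrier A \<Longrightarrow> q (h x) \<oplus>\<^bsub>C\<^esub> q (h y) = q (h (x \<oplus>\<^bsub>A\<^esub> y))"
    "\<And>x. x \<in> carrier A \<Longrightarrow> \<sim>\<^bsub>C\<^esub> (q (h x)) = q (h (\<sim>\<^bsub>A\<^esub> x))"
    "carrier C = q ` h ` carrier A"
    by (simp_all add: C_def rq hp hn h0)
  note cl = A.zero_closed A.plus_closed A.neg_closed
  have "h (\<sim>\<^bsub>A\<^esub> \<zero>\<^bsub>A\<^esub>) \<noteq> h \<zero>\<^bsub>A\<^esub>"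
    using B.neg_zero_neq by (simp add: h0 cl flip: hn)
  then have ne: "q (h (\<sim>\<^bsub>A\<^esub> \<zero>\<^bsub>A\<^esub>)) \<noteq> \<zero>\<^bsub>C\<^esub>"
    by (simp add: ops qeq cl)
  have "mv_algebra C"
  proof (rule mv_algebra.intro)
    show "comm_monoid \<lparr>carrier = carrier C, mult = mv_plus C, one = \<zero>\<^bsub>C\<^esub>\<rparr>"
    proof (rule comm_monoidI, goal_cases)
      case 5
      then show ?case using A.plus_comm by (fastforce simp: ops)
    qed (auto simp: ops cl A.plus_assoc A.zero_plus)
    show "carrier C \<noteq> {\<zero>\<^bsub>C\<^esub>}"
    proof -
      have "q (h (\<sim>\<^bsub>A\<^esub> \<zero>\<^bsub>A\<^esub>)) \<in> carrier C" by (simp add: ops cl)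
      then show ?thesis using ne by blast
    qed
    show "\<sim>\<^bsub>C\<^esub> (\<sim>\<^bsub>C\<^esub> x \<oplus>\<^bsub>C\<^esub> y) \<oplus>\<^bsub>C\<^esub> y = \<sim>\<^bsub>C\<^esub> (\<sim>\<^bsub>C\<^esub> y \<oplus>\<^bsub>C\<^esub> x) \<oplus>\<^bsub>C\<^esub> x"
      if "x \<in> carrier C" "y \<in> carrier C" for x y
      using that A.lukasiewicz by (auto simp: ops cl)
  qed (auto simp: ops cl A.neg_neg A.plus_neg_zero)
  moreover have "(\<lambda>x. q (h x)) \<in> mv_hom A C"
    by (auto simp: mv_hom_def ops)
  moreover have "mv_kernel A B h = mv_kernel A C (\<lambda>x. q (h x))"
    by (auto simp: mv_kernel_def ops qeq cl h0[symmetric])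
  ultimately show ?thesis unfolding mv_ideal_def by blast
qed

lemma topspace_max_spectrum:
  assumes "mv_algebra A"
  shows "topspace (max_spectrum A) = max_ideals A"
proof -
  interpret A: mv_algebra A by fact
  have "\<sim>\<^bsub>A\<^esub> \<zero>\<^bsub>A\<^esub> \<notin> M" if "M \<in> max_ideals A" for M
    using that mv_ideal_neg_zero[OF assms] by (simp add: max_ideals_def)
  moreover have "\<sim>\<^bsub>A\<^esub> \<zero>\<^bsub>A\<^esub> \<in> carrier A" using A.zero_closed A.neg_closed by blast
  ultimately show ?thesis
    unfolding max_spectrum_def topology_generated_by_topspace by blast
qed

end

theory Submission
  imports Defs "HOL-Homology.Invariance_of_Domain"
begin

text \<open>
  By Hoelder's theorem the maximal ideals of \<open>A\<close> are exactly the kernels of the characters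
  \<open>A \<rightarrow> [0,1]\<close>, and the value of a character at a fixed element depends continuously on the ideal.
  A surjective endomorphism \<open>h\<close> pulls maximal ideals back injectively and continuously; for
  semisimple \<open>A\<close> it is injective as soon as this self-map of the spectral space is onto, which on
  a compact manifold without boundary follows from invariance of domain.
  In the other two cases the values on the \<open>n\<close> generators embed the spectral space into
  \<open>\<real>\<^sup>n\<close>, and invariance of domain shows that every nonempty open set of maximal ideals has a member
  whose character is rational on the generators. Such a character takes values in some \<open>(1/d)\<int>\<close>.
  There are only finitely many characters of this kind for each \<open>d\<close>, so composition with \<open>h\<close>
  permutes them and they all vanish on the kernel of \<open>h\<close>, which is therefore trivial.
\<close>

text \<open>The argument for (i) cannot serve (ii) and (iii): an injective continuous self-map of a
  manifold with boundary need not be onto, as halving on [0,1] shows. The remedy is that the number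
  of generators equals the dimension, so evaluation at the generators, read in a chart, is an
  injective map between spaces of the same dimension and hence open. Even in (i), invariance of
  domain only makes the image clopen, and the space may be disconnected, so iterates of the map are
  brought in. For Hoelder's theorem the obstacle is truncation: multiples of an element stick at the
  top. They are therefore formed in a cone of pairs that counts completed units. The limiting count
  is a homomorphism from any chain to [0,1]; it may kill infinitesimals, and maximality of the ideal
  then pins down the kernel. Finally, the hull-kernel topology records only where elements vanish,
  so inequalities between values must be encoded as nonvanishing of other elements.\<close>

no_notation eq_closure_of (\<open>closure'_of\<index>\<close>)
no_notation ring.zero (\<open>\<zero>\<index>\<close>) and ring.add (infixl \<open>\<oplus>\<index>\<close> 65)
no_notation smult (infixl \<open>\<odot>\<index>\<close> 70)
no_notation a_minus (\<open>(\<open>notation=\<open>infix \<ominus>\<close>\<close>_ \<ominus>\<index> _)\<close> [65,66] 65)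

section \<open>The natural order\<close>

context mv_algebra
begin

declare zero_closed [simp] plus_closed [simp] neg_closed [simp] neg_neg [simp]

text \<open>On \<open>unit_interval\<close> the three notions are max 0 (x - y), max 0 (x + y - 1)
  and the usual order.\<close>

definition diff :: "'a \<Rightarrow> 'a \<Rightarrow> 'a" (infixl \<open>\<ominus>\<close> 65)
  where "x \<ominus> y = \<sim> (\<sim> x \<oplus> y)"

definition mul :: "'a \<Rightarrow> 'a \<Rightarrow> 'a" (infixl \<open>\<odot>\<close> 70)
  where "x \<odot> y = \<sim> (\<sim> x \<oplus> \<sim> y)"

definition le :: "'a \<Rightarrow> 'a \<Rightarrow> bool" (infix \<open>\<preceq>\<close> 50)
  where "x \<preceq> y \<longleftrightarrow> \<sim> x \<oplus> y = \<sim> \<zero>"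

lemma diff_closed [simp]: "x \<in> carrier A \<Longrightarrow> y \<in> carrier A \<Longrightarrow> x \<ominus> y \<in> carrier A"
  by (simp add: diff_def)

lemma mul_closed [simp]: "x \<in> carrier A \<Longrightarrow> y \<in> carrier A \<Longrightarrow> x \<odot> y \<in> carrier A"
  by (simp add: mul_def)

lemma plus_left_comm:
  "x \<in> carrier A \<Longrightarrow> y \<in> carrier A \<Longrightarrow> z \<in> carrier A \<Longrightarrow> x \<oplus> (y \<oplus> z) = y \<oplus> (x \<oplus> z)"
  by (metis plus_assoc plus_comm)

lemmas plus_ac = plus_assoc plus_comm plus_left_comm

lemma plus_zero [simp]: "x \<in> carrier A \<Longrightarrow> x \<oplus> \<zero> = x"
  by (metis plus_comm zero_plus zero_closed)

lemma top_plus [simp]: "x \<in> carrier A \<Longrightarrow> \<sim> \<zero> \<oplus> x = \<sim> \<zero>"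
  by (metis plus_neg_zero plus_comm neg_closed zero_closed)

text \<open>The axiom \<open>lukasiewicz\<close> at y = 1: its left side collapses to the
  top.\<close>

lemma neg_plus [simp]: "x \<in> carrier A \<Longrightarrow> \<sim> x \<oplus> x = \<sim> \<zero>"
  using lukasiewicz[of x "\<sim> \<zero>"] by (simp add: plus_neg_zero zero_plus)

declare plus_neg_zero [simp] zero_plus [simp]

lemma neg_inj: "x \<in> carrier A \<Longrightarrow> y \<in> carrier A \<Longrightarrow> \<sim> x = \<sim> y \<longleftrightarrow> x = y"
  by (metis neg_neg)

lemma diff_eq_zero_iff: "x \<in> carrier A \<Longrightarrow> y \<in> carrier A \<Longrightarrow> x \<ominus> y = \<zero> \<longleftrightarrow> x \<preceq> y"
  unfolding diff_def le_def by (metis neg_neg zero_closed plus_closed neg_closed)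

lemma mul_eq_zero_iff: "x \<in> carrier A \<Longrightarrow> y \<in> carrier A \<Longrightarrow> x \<odot> y = \<zero> \<longleftrightarrow> x \<preceq> \<sim> y"
  unfolding mul_def le_def by (metis neg_neg zero_closed plus_closed neg_closed)

lemma plus_eq_top_iff: "x \<in> carrier A \<Longrightarrow> y \<in> carrier A \<Longrightarrow> x \<oplus> y = \<sim> \<zero> \<longleftrightarrow> \<sim> x \<preceq> y"
  by (simp add: le_def)

lemma le_refl [simp]: "x \<in> carrier A \<Longrightarrow> x \<preceq> x"
  by (simp add: le_def)

text \<open>Both sides of \<open>lukasiewicz\<close> are formulas for the join; under the hypotheses
  one reduces to y and the other to x.\<close>

lemma le_antisym: "x \<in> carrier A \<Longrightarrow> y \<in> carrier A \<Longrightarrow> x \<preceq> y \<Longrightarrow> y \<preceq> x \<Longrightarrow> x = y"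
  unfolding le_def using lukasiewicz[of x y] by simp

lemma le_top [simp]: "x \<in> carrier A \<Longrightarrow> x \<preceq> \<sim> \<zero>"
  by (simp add: le_def)

lemma zero_le [simp]: "x \<in> carrier A \<Longrightarrow> \<zero> \<preceq> x"
  by (simp add: le_def)

lemma neg_le_iff: "x \<in> carrier A \<Longrightarrow> y \<in> carrier A \<Longrightarrow> \<sim> x \<preceq> \<sim> y \<longleftrightarrow> y \<preceq> x"
  by (simp add: le_def plus_comm)

lemma le_neg_iff: "x \<in> carrier A \<Longrightarrow> y \<in> carrier A \<Longrightarrow> x \<preceq> \<sim> y \<longleftrightarrow> y \<preceq> \<sim> x"
  by (simp add: le_def plus_comm)

lemma le_plus1 [simp]: "x \<in> carrier A \<Longrightarrow> y \<in> carrier A \<Longrightarrow> x \<preceq> x \<oplus> y"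
  by (simp add: le_def flip: plus_assoc)

lemma le_plus2 [simp]: "x \<in> carrier A \<Longrightarrow> y \<in> carrier A \<Longrightarrow> x \<preceq> y \<oplus> x"
  by (metis le_plus1 plus_comm)

text \<open>The same axiom. It provides a z with z \<oplus> x = y whenever x \<preceq> y, and from
  such witnesses come transitivity and monotonicity.\<close>

lemma diff_plus: "x \<in> carrier A \<Longrightarrow> y \<in> carrier A \<Longrightarrow> x \<preceq> y \<Longrightarrow> (y \<ominus> x) \<oplus> x = y"
  unfolding diff_def le_def using lukasiewicz[of x y] by simp

lemma plus_diff: "x \<in> carrier A \<Longrightarrow> y \<in> carrier A \<Longrightarrow> x \<preceq> y \<Longrightarrow> x \<oplus> (y \<ominus> x) = y"
  by (metis diff_plus plus_comm diff_closed)

lemma le_trans: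
  assumes "x \<in> carrier A" "y \<in> carrier A" "z \<in> carrier A" "x \<preceq> y" "y \<preceq> z"
  shows "x \<preceq> z"
proof -
  have "z = x \<oplus> ((y \<ominus> x) \<oplus> (z \<ominus> y))"
    using assms by (simp add: plus_diff flip: plus_assoc)
  then show ?thesis using assms by (metis le_plus1 diff_closed plus_closed)
qed

lemma plus_mono_right:
  assumes "x \<in> carrier A" "y \<in> carrier A" "z \<in> carrier A" "x \<preceq> y"
  shows "z \<oplus> x \<preceq> z \<oplus> y"
proof -
  have "z \<oplus> y = (z \<oplus> x) \<oplus> (y \<ominus> x)"
    using assms by (simp add: plus_diff plus_assoc)
  then show ?thesis using assms by (metis le_plus1 diff_closed plus_closed)
qed

lemma plus_mono:
  assumes "x \<in> carrier A" "y \<in> carrier A" "z \<in> carrier A" "w \<in> carrier A" "x \<preceq> y" "z \<preceq> w"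
  shows "x \<oplus> z \<preceq> y \<oplus> w"
  using plus_mono_right[of z w x] plus_mono_right[of x y w] assms
  by (metis le_trans plus_closed plus_comm)

text \<open>Residuation: both sides unfold to the same equation up to associativity. Most estimates
  below are read off from this adjunction.\<close>

lemma diff_le_iff:
  "x \<in> carrier A \<Longrightarrow> y \<in> carrier A \<Longrightarrow> z \<in> carrier A \<Longrightarrow> z \<ominus> x \<preceq> y \<longleftrightarrow> z \<preceq> x \<oplus> y"
  by (simp add: le_def diff_def plus_assoc)

lemma diff_le [simp]: "x \<in> carrier A \<Longrightarrow> y \<in> carrier A \<Longrightarrow> x \<ominus> y \<preceq> x"
  by (simp add: diff_le_iff)

lemma le_diff_plus [simp]: "x \<in> carrier A \<Longrightarrow> y \<in> carrier A \<Longrightarrow> x \<preceq> y \<oplus> (x \<ominus> y)"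
  by (simp flip: diff_le_iff)

lemma diff_le_neg [simp]: "x \<in> carrier A \<Longrightarrow> y \<in> carrier A \<Longrightarrow> x \<ominus> y \<preceq> \<sim> y"
  by (simp add: diff_le_iff plus_comm[of _ "\<sim> _"])

lemma diff_mono_left:
  assumes "x \<in> carrier A" "y \<in> carrier A" "z \<in> carrier A" "x \<preceq> y"
  shows "x \<ominus> z \<preceq> y \<ominus> z"
  using assms le_trans[OF _ _ _ assms(4) le_diff_plus[of y z]] by (simp add: diff_le_iff)

lemma neg_diff: "x \<in> carrier A \<Longrightarrow> y \<in> carrier A \<Longrightarrow> \<sim> (x \<ominus> y) = \<sim> x \<oplus> y"
  by (simp add: diff_def)

lemma neg_diff_neg: "x \<in> carrier A \<Longrightarrow> y \<in> carrier A \<Longrightarrow> \<sim> x \<ominus> \<sim> y = y \<ominus> x"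
  by (simp add: diff_def plus_comm)

text \<open>The hypothesis says that y \<oplus> x does not truncate. The claim is
  \<open>diff_plus\<close> for x and \<open>\<sim> y\<close>, complemented.\<close>

lemma plus_diff_cancel:
  assumes "x \<in> carrier A" "y \<in> carrier A" "y \<preceq> \<sim> x"
  shows "(y \<oplus> x) \<ominus> x = y"
proof -
  have "x \<preceq> \<sim> y" using assms by (simp add: le_neg_iff)
  then have "(\<sim> y \<ominus> x) \<oplus> x = \<sim> y" using assms by (simp add: diff_plus)
  then show ?thesis using assms by (simp add: diff_def)
qed

lemma diff_diff_cancel:
  assumes "x \<in> carrier A" "y \<in> carrier A" "x \<preceq> y"
  shows "y \<ominus> (y \<ominus> x) = x"
proof -
  have "x \<preceq> \<sim> (y \<ominus> x)" using assms by (simp add: neg_diff)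
  from plus_diff_cancel[OF _ _ this] show ?thesis using assms by (simp add: plus_diff)
qed

lemma diff_triangle:
  assumes "x \<in> carrier A" "y \<in> carrier A" "z \<in> carrier A"
  shows "x \<ominus> z \<preceq> (x \<ominus> y) \<oplus> (y \<ominus> z)"
proof -
  have "x \<preceq> y \<oplus> (x \<ominus> y)" using assms by simp
  also have "y \<oplus> (x \<ominus> y) \<preceq> (z \<oplus> (y \<ominus> z)) \<oplus> (x \<ominus> y)"
    using assms by (intro plus_mono) auto
  finally (le_trans[rotated 3]) show ?thesis
    using assms by (simp add: diff_le_iff plus_ac)
qed

lemma plus_diff_plus_le:
  assumes "x \<in> carrier A" "y \<in> carrier A" "z \<in> carrier A"
  shows "(x \<oplus> z) \<ominus> (y \<oplus> z) \<preceq> x \<ominus> y"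
proof -
  have "x \<oplus> z \<preceq> (y \<oplus> (x \<ominus> y)) \<oplus> z" using assms by (intro plus_mono) auto
  then show ?thesis using assms by (simp add: diff_le_iff plus_ac)
qed

section \<open>Meets, and the two facts about them that make maximal ideals prime\<close>

definition meet :: "'a \<Rightarrow> 'a \<Rightarrow> 'a" where "meet x y = x \<ominus> (x \<ominus> y)"

lemma meet_closed [simp]: "x \<in> carrier A \<Longrightarrow> y \<in> carrier A \<Longrightarrow> meet x y \<in> carrier A"
  by (simp add: meet_def)

lemma meet_le1 [simp]: "x \<in> carrier A \<Longrightarrow> y \<in> carrier A \<Longrightarrow> meet x y \<preceq> x"
  by (simp add: meet_def)

lemma meet_le2 [simp]: "x \<in> carrier A \<Longrightarrow> y \<in> carrier A \<Longrightarrow> meet x y \<preceq> y"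
  by (metis meet_def diff_le_iff diff_closed le_diff_plus plus_comm)

text \<open>The definition of \<open>meet\<close> is not visibly symmetric. Since x \<ominus> y =
  \<sim> y \<ominus> \<sim> x, the hypothesis on y bounds the difference by \<sim> w \<ominus>
  \<sim> x, which completes \<sim> x to \<sim> w.\<close>

lemma le_meetI:
  assumes "x \<in> carrier A" "y \<in> carrier A" "w \<in> carrier A" "w \<preceq> x" "w \<preceq> y"
  shows "w \<preceq> meet x y"
proof -
  have "x \<ominus> y = \<sim> y \<ominus> \<sim> x" using assms by (simp add: neg_diff_neg)
  also have "\<dots> \<preceq> \<sim> w \<ominus> \<sim> x" using assms by (intro diff_mono_left) (auto simp: neg_le_iff)
  finally have "\<sim> x \<oplus> (x \<ominus> y) \<preceq> \<sim> x \<oplus> (\<sim> w \<ominus> \<sim> x)"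
    using assms by (intro plus_mono_right) auto
  also have "\<dots> = \<sim> w" using assms by (intro plus_diff) (auto simp: neg_le_iff)
  finally have "\<sim> x \<oplus> (x \<ominus> y) \<preceq> \<sim> w" .
  then have "w \<preceq> \<sim> (\<sim> x \<oplus> (x \<ominus> y))"
    using assms by (simp add: le_neg_iff[of w])
  then show ?thesis by (simp add: meet_def diff_def[of x "x \<ominus> y"])
qed

lemma meet_plus_le:
  assumes "x \<in> carrier A" "y \<in> carrier A" "v \<in> carrier A"
  shows "meet (x \<oplus> y) v \<preceq> meet x v \<oplus> meet y v"
proof -
  \<comment> \<open>Addition distributes over meets: by residuation w \<ominus> a lies below b and
    c, hence below their meet. Two uses give the claim.\<close>
  have distrib: "w \<preceq> a \<oplus> meet b c"
    if "w \<preceq> a \<oplus> b" "w \<preceq> a \<oplus> c" "w \<in> carrier A" "a \<in> carrier A" "b \<in> carrier A" "c \<in> carrier A"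
    for w a b c
    using that le_meetI[of b c "w \<ominus> a"] by (simp add: diff_le_iff)
  let ?w = "meet (x \<oplus> y) v"
  have wv: "?w \<preceq> z \<oplus> v" "?w \<preceq> v \<oplus> z" if "z \<in> carrier A" for z
    using assms that le_trans[of ?w v] by simp_all
  have "?w \<preceq> y \<oplus> meet x v"
    using assms wv by (intro distrib) (auto simp: plus_comm[of y x])
  moreover have "?w \<preceq> v \<oplus> meet x v"
    using assms wv by simp
  ultimately have "?w \<preceq> meet x v \<oplus> meet y v"
    using assms by (intro distrib) (auto simp: plus_comm[of "meet x v"])
  then show ?thesis .
qed

text \<open>Adding the meet w of the differences to m = meet x y stays below x and below y, hence
  below m; as m \<oplus> w does not truncate, w = 0.\<close>

lemma meet_diff_diff:
  assumes "x \<in> carrier A" "y \<in> carrier A"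
  shows "meet (x \<ominus> y) (y \<ominus> x) = \<zero>"
proof -
  let ?w = "meet (x \<ominus> y) (y \<ominus> x)" and ?m = "meet x y"
  have sub: "x \<ominus> y = x \<ominus> ?m" "y \<ominus> x = y \<ominus> ?m"
  proof -
    have eq: "a \<ominus> b = a \<ominus> meet a b" if "a \<in> carrier A" "b \<in> carrier A" for a b
      using that by (simp add: meet_def diff_diff_cancel)
    have "meet x y = meet y x"
      using assms by (intro le_antisym le_meetI) auto
    then show "x \<ominus> y = x \<ominus> ?m" "y \<ominus> x = y \<ominus> ?m" using eq assms by auto
  qed
  have w: "?w \<in> carrier A" "?w \<preceq> x \<ominus> ?m" "?w \<preceq> y \<ominus> ?m"
    using assms sub by (metis diff_closed meet_closed meet_le1 meet_le2)+
  have "?m \<oplus> ?w \<preceq> ?m \<oplus> (x \<ominus> ?m)" "?m \<oplus> ?w \<preceq> ?m \<oplus> (y \<ominus> ?m)"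
    using assms w by (auto intro!: plus_mono_right)
  then have "?m \<oplus> ?w \<preceq> x" "?m \<oplus> ?w \<preceq> y"
    using assms by (simp_all add: plus_diff)
  then have "?w \<oplus> ?m \<preceq> ?m" using assms w by (simp add: le_meetI plus_comm)
  moreover have "?w \<preceq> \<sim> ?m"
    using assms w le_trans[of ?w "x \<ominus> ?m" "\<sim> ?m"] by simp
  ultimately have "?w \<preceq> ?m \<ominus> ?m"
    using assms w diff_mono_left[of "?w \<oplus> ?m" ?m ?m] by (simp add: plus_diff_cancel)
  also have "?m \<ominus> ?m = \<zero>" using assms by (simp add: diff_def)
  finally show ?thesis using assms by (intro le_antisym) auto
qed

text \<open>With b = \<sim> d the hypotheses read a \<preceq> d \<preceq> c and the claim becomes c
  \<ominus> (d \<ominus> a) = a \<oplus> (c \<ominus> d). It settles associativity of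
  \<open>cadd\<close> when exactly one of the two inner sums carries.\<close>

lemma mul_plus_eq_plus_mul:
  assumes "a \<in> carrier A" "b \<in> carrier A" "c \<in> carrier A" "a \<odot> b = \<zero>" "b \<oplus> c = \<sim> \<zero>"
  shows "(a \<oplus> b) \<odot> c = a \<oplus> (b \<odot> c)"
proof -
  define d where "d = \<sim> b"
  have d: "d \<in> carrier A" "b = \<sim> d" "a \<preceq> d" "d \<preceq> c"
    using assms by (auto simp: d_def mul_eq_zero_iff plus_eq_top_iff)
  have "a \<oplus> (c \<ominus> d) \<preceq> a \<oplus> \<sim> d"
    using assms d by (intro plus_mono_right) auto
  then have "a \<oplus> (c \<ominus> d) \<preceq> \<sim> (d \<ominus> a)"
    using assms d by (simp add: neg_diff plus_comm)
  moreover have "(a \<oplus> (c \<ominus> d)) \<oplus> (d \<ominus> a) = (c \<ominus> d) \<oplus> (a \<oplus> (d \<ominus> a))"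
    using assms d by (simp add: plus_ac)
  then have "(a \<oplus> (c \<ominus> d)) \<oplus> (d \<ominus> a) = c"
    using assms d by (simp add: plus_diff diff_plus)
  ultimately have "c \<ominus> (d \<ominus> a) = a \<oplus> (c \<ominus> d)"
    using assms d plus_diff_cancel[of "d \<ominus> a" "a \<oplus> (c \<ominus> d)"] by simp
  then show ?thesis
    using assms d by (simp add: mul_def diff_def plus_comm)
qed

text \<open>The right-hand side stays below \<sim> e, so e can be added to it, giving d, and
  cancelled again.\<close>

lemma diff_diff_plus_le:
  assumes "c \<in> carrier A" "d \<in> carrier A" "e \<in> carrier A" "e \<preceq> c" "c \<preceq> d"
  shows "d \<ominus> e = (d \<ominus> c) \<oplus> (c \<ominus> e)"
proof -
  have "(d \<ominus> c) \<oplus> (c \<ominus> e) \<preceq> \<sim> c \<oplus> (\<sim> e \<ominus> \<sim> c)"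
    using assms by (intro plus_mono) (auto simp: neg_diff_neg)
  also have "\<dots> = \<sim> e" using assms by (simp add: plus_diff neg_le_iff)
  finally have "(((d \<ominus> c) \<oplus> (c \<ominus> e)) \<oplus> e) \<ominus> e = (d \<ominus> c) \<oplus> (c \<ominus> e)"
    using assms by (intro plus_diff_cancel) auto
  then show ?thesis using assms by (simp add: plus_assoc diff_plus)
qed

end

section \<open>Chains\<close>

locale mv_chain = mv_algebra +
  assumes total: "x \<in> carrier A \<Longrightarrow> y \<in> carrier A \<Longrightarrow> x \<preceq> y \<or> y \<preceq> x"
begin

text \<open>This is where linearity enters: a sum either loses nothing or reaches the top with
  overflow x \<odot> y. In a product of chains, different coordinates could behave
  differently.\<close>

lemma mul_eq_zero: "x \<in> carrier A \<Longrightarrow> y \<in> carrier A \<Longrightarrow> x \<oplus> y \<noteq> \<sim> \<zero> \<Longrightarrow> x \<odot> y = \<zero>"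
  using total[of "\<sim> x" y] by (auto simp: mul_eq_zero_iff plus_eq_top_iff le_neg_iff[of x])

text \<open>Both sides stand for max 0 (a + c - d), which is symmetric in a and c, so one inequality
  suffices.\<close>

lemma diff_diff_le:
  assumes "a \<in> carrier A" "c \<in> carrier A" "d \<in> carrier A" "a \<preceq> d" "c \<preceq> d"
  shows "c \<ominus> (d \<ominus> a) \<preceq> a \<ominus> (d \<ominus> c)"
proof (cases "c \<preceq> d \<ominus> a")
  case True
  then have "c \<ominus> (d \<ominus> a) = \<zero>" using assms by (simp add: diff_eq_zero_iff)
  then show ?thesis using assms by simp
next
  case False
  then have e: "d \<ominus> a \<preceq> c" using assms total[of c "d \<ominus> a"] by auto
  let ?z = "c \<ominus> (d \<ominus> a)"
  have "d \<ominus> (d \<ominus> a) = (d \<ominus> c) \<oplus> ?z"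
    using assms e by (intro diff_diff_plus_le) auto
  then have a: "a = ?z \<oplus> (d \<ominus> c)" using assms by (simp add: diff_diff_cancel plus_comm)
  have "?z \<preceq> \<sim> (d \<ominus> c)"
    using assms le_trans[of ?z c "\<sim> d \<oplus> c"] by (simp add: neg_diff)
  then have "(?z \<oplus> (d \<ominus> c)) \<ominus> (d \<ominus> c) = ?z" using assms by (simp add: plus_diff_cancel)
  then show ?thesis using assms by (simp flip: a)
qed

lemma plus_mul_eq_mul_plus:
  assumes "a \<in> carrier A" "b \<in> carrier A" "c \<in> carrier A" "a \<odot> b = \<zero>" "b \<odot> c = \<zero>"
  shows "(a \<oplus> b) \<odot> c = a \<odot> (b \<oplus> c)"
proof -
  define d where "d = \<sim> b"
  have d: "d \<in> carrier A" "b = \<sim> d" "a \<preceq> d" "c \<preceq> d"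
    using assms by (auto simp: d_def mul_eq_zero_iff le_neg_iff[of b])
  have "c \<ominus> (d \<ominus> a) = a \<ominus> (d \<ominus> c)"
    using assms d diff_diff_le[of a c d] diff_diff_le[of c a d] by (intro le_antisym) auto
  then show ?thesis using assms d by (simp add: mul_def diff_def plus_comm)
qed

text \<open>De Morgan dual of \<open>plus_mul_eq_mul_plus\<close>: complementing turns two carries
  into none.\<close>

lemma mul_plus_eq_plus_mul':
  assumes "a \<in> carrier A" "b \<in> carrier A" "c \<in> carrier A" "a \<oplus> b = \<sim> \<zero>" "b \<oplus> c = \<sim> \<zero>"
  shows "(a \<odot> b) \<oplus> c = a \<oplus> (b \<odot> c)"
proof -
  have "(\<sim> a \<oplus> \<sim> b) \<odot> \<sim> c = \<sim> a \<odot> (\<sim> b \<oplus> \<sim> c)"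
    using assms by (intro plus_mul_eq_mul_plus) (auto simp: mul_def)
  then have "\<sim> ((\<sim> a \<oplus> \<sim> b) \<odot> \<sim> c) = \<sim> (\<sim> a \<odot> (\<sim> b \<oplus> \<sim> c))" by simp
  then show ?thesis using assms by (simp add: mul_def)
qed

end

section \<open>Hoelder's theorem\<close>

definition unit_interval :: "real mv_algebra" where
  "unit_interval = \<lparr>carrier = {0..1}, mv_plus = (\<lambda>x y. min 1 (x + y)), mv_zero = 0, mv_neg = (\<lambda>x. 1 - x)\<rparr>"

lemma unit_interval_simps [simp]:
  "carrier unit_interval = {0..1}" "mv_plus unit_interval x y = min 1 (x + y)"
  "mv_zero unit_interval = 0" "mv_neg unit_interval x = 1 - x"
  by (simp_all add: unit_interval_def)

lemma mv_algebra_unit_interval: "mv_algebra unit_interval"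
proof (rule mv_algebra.intro)
  show "comm_monoid \<lparr>carrier = carrier unit_interval, mult = mv_plus unit_interval, one = mv_zero unit_interval\<rparr>"
    by (rule comm_monoidI) auto
  have "(1::real) \<in> {0..1}" by simp
  then show "carrier unit_interval \<noteq> {mv_zero unit_interval}"
    by (metis singletonD unit_interval_simps(1,3) zero_neq_one)
  show "mv_plus unit_interval (mv_neg unit_interval (mv_plus unit_interval (mv_neg unit_interval x) y)) y
    = mv_plus unit_interval (mv_neg unit_interval (mv_plus unit_interval (mv_neg unit_interval y) x)) x"
    if "x \<in> carrier unit_interval" "y \<in> carrier unit_interval" for x y
    using that by (cases "x \<le> y") auto
qed auto

context mv_algebra
begin

lemma mul_comm: "x \<in> carrier A \<Longrightarrow> y \<in> carrier A \<Longrightarrow> x \<odot> y = y \<odot> x"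
  by (simp add: mul_def plus_comm)

lemma mul_assoc: "x \<in> carrier A \<Longrightarrow> y \<in> carrier A \<Longrightarrow> z \<in> carrier A \<Longrightarrow> x \<odot> y \<odot> z = x \<odot> (y \<odot> z)"
  by (simp add: mul_def plus_assoc)

lemma mul_le1 [simp]: "x \<in> carrier A \<Longrightarrow> y \<in> carrier A \<Longrightarrow> x \<odot> y \<preceq> x"
  using neg_le_iff[of "\<sim> x \<oplus> \<sim> y" "\<sim> x"] by (simp add: mul_def)

lemma top_le: "x \<in> carrier A \<Longrightarrow> \<sim> \<zero> \<preceq> x \<longleftrightarrow> x = \<sim> \<zero>"
  by (simp add: le_def)

lemma top_mul [simp]: "x \<in> carrier A \<Longrightarrow> \<sim> \<zero> \<odot> x = x"
  by (simp add: mul_def)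

lemma mul_top [simp]: "x \<in> carrier A \<Longrightarrow> x \<odot> \<sim> \<zero> = x"
  by (simp add: mul_def)

lemma mul_neg [simp]: "x \<in> carrier A \<Longrightarrow> x \<odot> \<sim> x = \<zero>"
  by (simp add: mul_eq_zero_iff)

end

context mv_chain
begin

text \<open>The pair \<open>(m, r)\<close> stands for \<open>m \<cdot> 1 + r\<close> in the positive cone of Chang's enveloping group;
  a sum that reaches the top is reduced with a carry.\<close>
definition cadd :: "nat \<times> 'a \<Rightarrow> nat \<times> 'a \<Rightarrow> nat \<times> 'a" where
  "cadd x y = (if snd x \<oplus> snd y = \<sim> \<zero> then (fst x + fst y + 1, snd x \<odot> snd y)
    else (fst x + fst y, snd x \<oplus> snd y))"

text \<open>The top is excluded as a remainder because m + 1 units are already represented by (m +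
  1, 0); with it, (0, 0) would not be neutral.\<close>

definition cone :: "(nat \<times> 'a) monoid" where
  "cone = \<lparr>carrier = {x. snd x \<in> carrier A \<and> snd x \<noteq> \<sim> \<zero>}, mult = cadd, one = (0, \<zero>)\<rparr>"

lemma mul_neq_top:
  assumes "x \<in> carrier A" "y \<in> carrier A" "x \<noteq> \<sim> \<zero>"
  shows "x \<odot> y \<noteq> \<sim> \<zero>"
  using mul_le1[of x y] assms top_le[of x] by metis

text \<open>Cases by which of a \<oplus> b and b \<oplus> c carries. In the two mixed cases
  \<open>neq\<close> excludes a second carry on the side that has already had one.\<close>

lemma cadd_assoc:
  assumes "a \<in> carrier A" "b \<in> carrier A" "c \<in> carrier A"
  shows "cadd (cadd (m, a) (n, b)) (k, c) = cadd (m, a) (cadd (n, b) (k, c))"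
proof -
  have neq: "(x \<oplus> y) \<odot> z \<noteq> \<sim> \<zero>"
    if "x \<in> carrier A" "y \<in> carrier A" "z \<in> carrier A" "x \<oplus> y \<noteq> \<sim> \<zero>" for x y z
    using that by (intro mul_neq_top) auto
  consider "a \<oplus> b \<noteq> \<sim> \<zero>" "b \<oplus> c \<noteq> \<sim> \<zero>" | "a \<oplus> b \<noteq> \<sim> \<zero>" "b \<oplus> c = \<sim> \<zero>"
    | "a \<oplus> b = \<sim> \<zero>" "b \<oplus> c \<noteq> \<sim> \<zero>" | "a \<oplus> b = \<sim> \<zero>" "b \<oplus> c = \<sim> \<zero>" by blast
  then show ?thesis
  proof cases
    case 1
    then have "(a \<oplus> b) \<odot> c = a \<odot> (b \<oplus> c)"
      using assms by (intro plus_mul_eq_mul_plus mul_eq_zero) auto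
    then show ?thesis using 1 assms by (simp add: cadd_def plus_assoc)
  next
    case 2
    then have "(a \<oplus> b) \<odot> c = a \<oplus> (b \<odot> c)"
      using assms by (intro mul_plus_eq_plus_mul mul_eq_zero) auto
    moreover from this have "a \<oplus> (b \<odot> c) \<noteq> \<sim> \<zero>" using neq[of a b c] 2 assms by simp
    ultimately show ?thesis using 2 assms by (simp add: cadd_def plus_assoc)
  next
    case 3
    then have "(c \<oplus> b) \<odot> a = c \<oplus> (b \<odot> a)"
      using assms by (intro mul_plus_eq_plus_mul mul_eq_zero) (auto simp: plus_comm)
    then have *: "a \<odot> (b \<oplus> c) = (a \<odot> b) \<oplus> c"
      using assms by (simp add: plus_comm mul_comm)
    moreover have "a \<odot> b \<oplus> c \<noteq> \<sim> \<zero>"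
      using neq[of b c a] * 3 assms by (simp add: mul_comm)
    moreover have "a \<oplus> (b \<oplus> c) = \<sim> \<zero>" using 3 assms by (simp flip: plus_assoc)
    ultimately show ?thesis using 3 assms by (simp add: cadd_def)
  next
    case 4
    then have "(a \<odot> b) \<oplus> c = a \<oplus> (b \<odot> c)"
      using assms by (intro mul_plus_eq_plus_mul') auto
    then show ?thesis using 4 assms by (simp add: cadd_def mul_assoc)
  qed
qed

lemma comm_monoid_cone: "comm_monoid cone"
proof (rule comm_monoidI)
  fix x y assume "x \<in> carrier cone" "y \<in> carrier cone"
  then show "x \<otimes>\<^bsub>cone\<^esub> y \<in> carrier cone"
    by (simp add: cone_def cadd_def mul_neq_top)
next
  show "\<one>\<^bsub>cone\<^esub> \<in> carrier cone" using neg_zero_neq by (simp add: cone_def neg_zero_neq[symmetric])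
qed (auto simp: cone_def cadd_assoc, auto simp: cadd_def plus_comm mul_comm)

section \<open>Counting units in multiples, and the limiting density\<close>

definition emb :: "'a \<Rightarrow> nat \<times> 'a" where
  "emb a = (if a = \<sim> \<zero> then (1, \<zero>) else (0, a))"

text \<open>The number of whole units in the k-fold multiple of a; for a real number a in [0,1] it
  would be the floor of k a.\<close>

definition count :: "nat \<Rightarrow> 'a \<Rightarrow> nat" where
  "count k a = fst (emb a [^]\<^bsub>cone\<^esub> k)"

lemma emb_closed [simp]: "a \<in> carrier A \<Longrightarrow> emb a \<in> carrier cone"
  by (auto simp: emb_def cone_def neg_zero_neq[symmetric])

text \<open>In the cone the truncated sum and its overflow recombine to the true sum. No truncation
  is left in this identity, so it survives taking powers.\<close>

lemma emb_mult:
  assumes "a \<in> carrier A" "b \<in> carrier A"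
  shows "emb a \<otimes>\<^bsub>cone\<^esub> emb b = emb (a \<oplus> b) \<otimes>\<^bsub>cone\<^esub> emb (a \<odot> b)"
proof (cases "a \<oplus> b = \<sim> \<zero>")
  case False
  then have "a \<noteq> \<sim> \<zero>" "b \<noteq> \<sim> \<zero>" "a \<odot> b = \<zero>" using assms mul_eq_zero by auto
  then show ?thesis
    using False assms neg_zero_neq by (simp add: emb_def cone_def cadd_def)
next
  case True
  then show ?thesis
    using assms neg_zero_neq mul_neq_top[of a b]
    by (cases "a = \<sim> \<zero>"; cases "b = \<sim> \<zero>") (auto simp: emb_def cone_def cadd_def)
qed

lemma fst_mult:
  "fst x + fst y \<le> fst (x \<otimes>\<^bsub>cone\<^esub> y)" "fst (x \<otimes>\<^bsub>cone\<^esub> y) \<le> fst x + fst y + 1"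
  by (simp_all add: cone_def cadd_def)

lemma count_double:
  assumes "a \<in> carrier A"
  shows "2 * count k a \<le> count (2 * k) a"
proof -
  interpret C: comm_monoid cone by (rule comm_monoid_cone)
  have "emb a [^]\<^bsub>cone\<^esub> (2 * k) = emb a [^]\<^bsub>cone\<^esub> k \<otimes>\<^bsub>cone\<^esub> emb a [^]\<^bsub>cone\<^esub> k"
    using assms by (simp add: C.nat_pow_mult mult_2)
  then show ?thesis
    using fst_mult(1)[of "emb a [^]\<^bsub>cone\<^esub> k" "emb a [^]\<^bsub>cone\<^esub> k"] by (simp add: count_def)
qed

lemma count_le:
  assumes "a \<in> carrier A"
  shows "count k a \<le> k"
proof (induction k)
  case 0
  then show ?case by (simp add: count_def cone_def)
next
  case (Suc k)
  interpret C: comm_monoid cone by (rule comm_monoid_cone)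
  have "emb a [^]\<^bsub>cone\<^esub> k \<in> carrier cone" using assms by simp
  then show ?case
    using Suc assms by (auto simp: count_def emb_def cone_def cadd_def)
qed

lemma count_power_le:
  assumes "a \<in> carrier A"
  shows "count (2 ^ k) a / 2 ^ k \<le> (1::real)"
proof -
  have "real (count (2 ^ k) a) \<le> real (2 ^ k)"
    using count_le[OF assms] by (simp only: of_nat_le_iff)
  then show ?thesis by simp
qed

lemma count_zero: "count k \<zero> = 0"
proof -
  have "emb \<zero> [^]\<^bsub>cone\<^esub> k = (0, \<zero>)"
    by (induction k) (auto simp: cone_def emb_def cadd_def neg_zero_neq[symmetric])
  then show ?thesis by (simp add: count_def)
qed

lemma count_top: "count k (\<sim> \<zero>) = k"
proof -
  have "emb (\<sim> \<zero>) [^]\<^bsub>cone\<^esub> k = (k, \<zero>)"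
    using neg_zero_neq by (induction k) (auto simp: cone_def emb_def cadd_def)
  then show ?thesis by (simp add: count_def)
qed

text \<open>The k-th power of \<open>emb_mult\<close>, by commutativity. On each side the final
  addition contributes at most one carry, hence the defect 1.\<close>

lemma count_plus:
  assumes "a \<in> carrier A" "b \<in> carrier A"
  shows "\<bar>real (count k a) + count k b - (count k (a \<oplus> b) + count k (a \<odot> b))\<bar> \<le> 1"
proof -
  interpret C: comm_monoid cone by (rule comm_monoid_cone)
  have "emb a [^]\<^bsub>cone\<^esub> k \<otimes>\<^bsub>cone\<^esub> emb b [^]\<^bsub>cone\<^esub> k
      = emb (a \<oplus> b) [^]\<^bsub>cone\<^esub> k \<otimes>\<^bsub>cone\<^esub> emb (a \<odot> b) [^]\<^bsub>cone\<^esub> k"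
    using assms emb_mult[OF assms] by (simp add: C.m_comm flip: C.pow_mult_distrib)
  then show ?thesis
    using fst_mult[of "emb a [^]\<^bsub>cone\<^esub> k" "emb b [^]\<^bsub>cone\<^esub> k"]
      fst_mult[of "emb (a \<oplus> b) [^]\<^bsub>cone\<^esub> k" "emb (a \<odot> b) [^]\<^bsub>cone\<^esub> k"]
    by (simp add: count_def)
qed

text \<open>Along powers of two the quotients increase, by \<open>count_double\<close>, and are
  bounded by 1, so the limit exists.\<close>

definition density :: "'a \<Rightarrow> real" where
  "density a = lim (\<lambda>k. count (2 ^ k) a / 2 ^ k)"

lemma density_LIMSEQ:
  assumes "a \<in> carrier A"
  shows "(\<lambda>k. count (2 ^ k) a / 2 ^ k) \<longlonglongrightarrow> density a"
proof -
  have "incseq (\<lambda>k. count (2 ^ k) a / 2 ^ k)"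
  proof (rule incseq_SucI)
    fix k
    have "2 * real (count (2 ^ k) a) \<le> count (2 * 2 ^ k) a"
      using count_double[OF assms, of "2 ^ k"] by linarith
    then show "real (count (2 ^ k) a) / 2 ^ k \<le> count (2 ^ Suc k) a / 2 ^ Suc k"
      by (simp add: field_simps)
  qed
  then obtain L where "(\<lambda>k. count (2 ^ k) a / 2 ^ k) \<longlonglongrightarrow> L"
    using incseq_convergent[of "\<lambda>k. count (2 ^ k) a / 2 ^ k" 1] count_power_le[OF assms] by blast
  then show ?thesis
    unfolding density_def using limI by fastforce
qed

lemma density_bounds:
  assumes "a \<in> carrier A"
  shows "0 \<le> density a" "density a \<le> 1"
proof -
  show "0 \<le> density a" by (rule LIMSEQ_le_const[OF density_LIMSEQ[OF assms]]) auto
  show "density a \<le> 1"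
    by (rule LIMSEQ_le_const2[OF density_LIMSEQ[OF assms]]) (use count_power_le[OF assms] in blast)
qed

lemma density_top: "density (\<sim> \<zero>) = 1"
  by (simp add: density_def count_top)

lemma density_plus:
  assumes "a \<in> carrier A" "b \<in> carrier A"
  shows "density a + density b = density (a \<oplus> b) + density (a \<odot> b)"
proof -
  let ?f = "\<lambda>k. real (count (2 ^ k) a) / 2 ^ k + count (2 ^ k) b / 2 ^ k
    - (count (2 ^ k) (a \<oplus> b) / 2 ^ k + count (2 ^ k) (a \<odot> b) / 2 ^ k)"
  have "?f \<longlonglongrightarrow> density a + density b - (density (a \<oplus> b) + density (a \<odot> b))"
    using assms by (intro tendsto_intros density_LIMSEQ) auto
  \<comment> \<open>The defect 1 of \<open>count_plus\<close> becomes 1 / 2 ^ k after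
    division.\<close>
  moreover have "?f \<longlonglongrightarrow> 0"
  proof (rule tendsto_0_le)
    show "(\<lambda>k. (1/2::real) ^ k) \<longlonglongrightarrow> 0" by (intro LIMSEQ_realpow_zero) auto
    show "eventually (\<lambda>k. norm (?f k) \<le> norm ((1/2::real) ^ k) * 1) sequentially"
    proof (intro always_eventually allI)
      fix k
      have "?f k = (real (count (2 ^ k) a) + count (2 ^ k) b - (count (2 ^ k) (a \<oplus> b) + count (2 ^ k) (a \<odot> b))) / 2 ^ k"
        by (simp add: field_simps)
      then show "norm (?f k) \<le> norm ((1/2::real) ^ k) * 1"
        using count_plus[OF assms, of "2 ^ k"] by (simp add: divide_right_mono power_one_over)
    qed
  qed
  ultimately show ?thesis using LIMSEQ_unique by fastforce
qed

lemma density_zero: "density \<zero> = 0"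
  by (simp add: density_def count_zero)

text \<open>The two branches of min match the two cases of a chain: below the top the overflow is 0,
  and at the top \<open>density_plus\<close> makes the sum of the densities at least 1.\<close>

theorem density_hom: "density \<in> mv_hom A unit_interval"
proof -
  have "density (a \<oplus> b) = min 1 (density a + density b)" if "a \<in> carrier A" "b \<in> carrier A" for a b
    using density_plus[OF that] mul_eq_zero[OF that] density_zero density_top that
      density_bounds[of "a \<oplus> b"] density_bounds[of "a \<odot> b"]
    by (cases "a \<oplus> b = \<sim> \<zero>") auto
  moreover have "density (\<sim> a) = 1 - density a" if "a \<in> carrier A" for a
    using density_plus[of a "\<sim> a"] that density_top density_zero by (simp add: plus_comm[of a])
  ultimately show ?thesis
    using density_bounds density_zero by (simp add: mv_hom_def)
qed

end

section \<open>Maximal ideals and characters\<close>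

context mv_algebra
begin

section \<open>Order-theoretic ideals and Zorn's lemma\<close>

definition proper_ideal :: "'a set \<Rightarrow> bool" where
  "proper_ideal J \<longleftrightarrow> J \<subseteq> carrier A \<and> \<zero> \<in> J \<and> \<sim> \<zero> \<notin> J \<and> (\<forall>x\<in>J. \<forall>y\<in>J. x \<oplus> y \<in> J)
     \<and> (\<forall>x\<in>J. \<forall>y\<in>carrier A. y \<preceq> x \<longrightarrow> y \<in> J)"

definition maximal_proper :: "'a set \<Rightarrow> bool" where
  "maximal_proper M \<longleftrightarrow> proper_ideal M \<and> (\<forall>I. proper_ideal I \<and> M \<subseteq> I \<longrightarrow> I = M)"

lemma proper_idealD:
  assumes "proper_ideal J"
  shows "J \<subseteq> carrier A" "\<zero> \<in> J" "\<sim> \<zero> \<notin> J"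
    "x \<in> J \<Longrightarrow> x \<in> carrier A"
    "x \<in> J \<Longrightarrow> y \<in> J \<Longrightarrow> x \<oplus> y \<in> J"
    "x \<in> J \<Longrightarrow> y \<in> carrier A \<Longrightarrow> y \<preceq> x \<Longrightarrow> y \<in> J"
  using assms unfolding proper_ideal_def by blast+

lemma proper_idealI:
  assumes "J \<subseteq> carrier A" "\<zero> \<in> J" "\<sim> \<zero> \<notin> J"
    "\<And>x y. x \<in> J \<Longrightarrow> y \<in> J \<Longrightarrow> x \<oplus> y \<in> J"
    "\<And>x y. x \<in> J \<Longrightarrow> y \<in> carrier A \<Longrightarrow> y \<preceq> x \<Longrightarrow> y \<in> J"
  shows "proper_ideal J"
  using assms unfolding proper_ideal_def by blast

lemma proper_ideal_kernel:
  assumes "mv_algebra B" "h \<in> mv_hom A B"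
  shows "proper_ideal (mv_kernel A B h)"
proof -
  interpret B: mv_algebra B by fact
  have h: "h \<zero> = \<zero>\<^bsub>B\<^esub>" "\<And>x. x \<in> carrier A \<Longrightarrow> h x \<in> carrier B"
    "\<And>x y. x \<in> carrier A \<Longrightarrow> y \<in> carrier A \<Longrightarrow> h (x \<oplus> y) = h x \<oplus>\<^bsub>B\<^esub> h y"
    "\<And>x. x \<in> carrier A \<Longrightarrow> h (\<sim> x) = \<sim>\<^bsub>B\<^esub> (h x)"
    using assms(2) by (auto simp: mv_hom_def)
  have "h y = \<zero>\<^bsub>B\<^esub>" if "x \<in> carrier A" "y \<in> carrier A" "h x = \<zero>\<^bsub>B\<^esub>" "y \<preceq> x" for x y
  proof -
    have "h (\<sim> y \<oplus> x) = h (\<sim> \<zero>)" using that by (simp add: le_def)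
    then have "\<sim>\<^bsub>B\<^esub> (h y) = \<sim>\<^bsub>B\<^esub> \<zero>\<^bsub>B\<^esub>" using that h by simp
    then show ?thesis using B.neg_inj h that by simp
  qed
  moreover have "\<sim> \<zero> \<notin> mv_kernel A B h"
    using h B.neg_zero_neq by (simp add: mv_kernel_def)
  moreover have "x \<oplus> y \<in> mv_kernel A B h" if "x \<in> mv_kernel A B h" "y \<in> mv_kernel A B h" for x y
    using h that B.zero_closed by (simp add: mv_kernel_def)
  ultimately show ?thesis
    using h(1) unfolding proper_ideal_def by (auto simp: mv_kernel_def)
qed

lemma ex_maximal_proper:
  assumes "proper_ideal J"
  obtains M where "maximal_proper M" "J \<subseteq> M"
proof -
  let ?P = "{I. proper_ideal I \<and> J \<subseteq> I}"
  have "\<exists>M\<in>?P. \<forall>X\<in>?P. M \<subseteq> X \<longrightarrow> X = M"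
  proof (rule subset_Zorn_nonempty)
    show "?P \<noteq> {}" using assms by blast
    fix C assume C: "C \<noteq> {}" "subset.chain ?P C"
    have P: "proper_ideal I" "J \<subseteq> I" if "I \<in> C" for I
      using C(2) that by (auto simp: subset_chain_def)
    have "x \<oplus> y \<in> \<Union> C" if xy: "x \<in> \<Union> C" "y \<in> \<Union> C" for x y
    proof -
      obtain I K where IK: "I \<in> C" "K \<in> C" "x \<in> I" "y \<in> K" using xy by blast
      then have "I \<subseteq> K \<or> K \<subseteq> I" using C(2) by (auto simp: subset_chain_def)
      then show ?thesis using IK P proper_idealD(5) by (meson UnionI subsetD)
    qed
    moreover have "\<Union> C \<subseteq> carrier A" "\<sim> \<zero> \<notin> \<Union> C"
      using P(1) proper_idealD(1,3) by blast+
    moreover have "\<zero> \<in> \<Union> C"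
      using P(1) C(1) proper_idealD(2) by blast
    moreover have "y \<in> \<Union> C" if "x \<in> \<Union> C" "y \<in> carrier A" "y \<preceq> x" for x y
      using that P(1) proper_idealD(6) by blast
    ultimately have "proper_ideal (\<Union> C)"
      unfolding proper_ideal_def by simp
    then show "\<Union> C \<in> ?P" using P C(1) by blast
  qed
  then obtain M where "proper_ideal M" "J \<subseteq> M" "\<forall>X\<in>?P. M \<subseteq> X \<longrightarrow> X = M" by blast
  then have "maximal_proper M" unfolding maximal_proper_def by blast
  then show ?thesis using that \<open>J \<subseteq> M\<close> by blast
qed

text \<open>For v outside M, the set of all z with meet z v in M is an ideal (sums by
  \<open>meet_plus_le\<close>), is proper because the top meets v in v, and contains M. Maximality
  makes it M, and by \<open>meet_diff_diff\<close> it contains x \<ominus> y when v = y \<ominus>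
  x.\<close>

lemma maximal_proper_prime:
  assumes M: "maximal_proper M" and x: "x \<in> carrier A" and y: "y \<in> carrier A"
  shows "x \<ominus> y \<in> M \<or> y \<ominus> x \<in> M"
proof (rule disjCI)
  define v where "v = y \<ominus> x"
  assume "y \<ominus> x \<notin> M"
  then have v: "v \<in> carrier A" "v \<notin> M" using x y by (auto simp: v_def)
  have P: "proper_ideal M" using M by (simp add: maximal_proper_def)
  note PD = proper_idealD[OF P]
  let ?I = "{z \<in> carrier A. meet z v \<in> M}"
  have "meet \<zero> v = \<zero>" using v by (intro le_antisym) auto
  then have "\<zero> \<in> ?I" using PD(2) by simp
  moreover have "meet (\<sim> \<zero>) v = v" using v by (intro le_antisym le_meetI) auto
  then have "\<sim> \<zero> \<notin> ?I" using v by simp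
  moreover have "a \<oplus> b \<in> ?I" if "a \<in> ?I" "b \<in> ?I" for a b
    using that v PD(5)[of "meet a v" "meet b v"] meet_plus_le[of a b v]
      PD(6)[of "meet a v \<oplus> meet b v" "meet (a \<oplus> b) v"] by simp
  moreover have "b \<in> ?I" if "a \<in> ?I" "b \<in> carrier A" "b \<preceq> a" for a b
  proof -
    have "meet b v \<preceq> meet a v"
      using that v le_trans[of "meet b v" b a] by (intro le_meetI) auto
    then show ?thesis using that v PD(6)[of "meet a v" "meet b v"] by simp
  qed
  ultimately have "proper_ideal ?I"
    unfolding proper_ideal_def by blast
  moreover have "M \<subseteq> ?I"
  proof
    fix z assume "z \<in> M"
    then show "z \<in> ?I" using PD(6)[of z "meet z v"] PD(4)[of z] v by simp
  qed
  ultimately have "?I = M" using M by (simp add: maximal_proper_def)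
  moreover have "x \<ominus> y \<in> ?I" using meet_diff_diff[OF x y] PD(2) x y by (simp add: v_def)
  ultimately show "x \<ominus> y \<in> M" by simp
qed

section \<open>Congruence modulo an ideal and the quotient algebra\<close>

definition cong :: "'a set \<Rightarrow> 'a \<Rightarrow> 'a \<Rightarrow> bool" where
  "cong J x y \<longleftrightarrow> x \<ominus> y \<in> J \<and> y \<ominus> x \<in> J"

text \<open>The selecting predicate depends only on the class of x, so congruent elements receive
  the same representative and the quotient can live on the type \<open>'a\<close> itself.\<close>

definition rep :: "'a set \<Rightarrow> 'a \<Rightarrow> 'a" where
  "rep J x = (SOME y. y \<in> carrier A \<and> cong J x y)"

text \<open>The quotient by \<open>J\<close>, with the congruence classes replaced by chosen representatives.\<close>
definition quot :: "'a set \<Rightarrow> 'a mv_algebra" where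
  "quot J = \<lparr>carrier = rep J ` carrier A, mv_plus = (\<lambda>x y. rep J (x \<oplus> y)), mv_zero = rep J \<zero>,
     mv_neg = (\<lambda>x. rep J (\<sim> x))\<rparr>"

context
  fixes J assumes J: "proper_ideal J"
begin

lemma cong_refl: "x \<in> carrier A \<Longrightarrow> cong J x x"
  using proper_idealD(2)[OF J] by (simp add: cong_def diff_def)

lemma cong_sym: "cong J x y \<Longrightarrow> cong J y x"
  by (auto simp: cong_def)

lemma cong_trans:
  assumes "x \<in> carrier A" "y \<in> carrier A" "z \<in> carrier A" "cong J x y" "cong J y z"
  shows "cong J x z"
proof -
  have "x \<ominus> y \<oplus> (y \<ominus> z) \<in> J" "z \<ominus> y \<oplus> (y \<ominus> x) \<in> J"
    using assms proper_idealD(5)[OF J] by (auto simp: cong_def)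
  then show ?thesis
    using assms diff_triangle[of x y z] diff_triangle[of z y x] proper_idealD(6)[OF J]
    by (auto simp: cong_def)
qed

lemma cong_neg:
  "x \<in> carrier A \<Longrightarrow> y \<in> carrier A \<Longrightarrow> cong J x y \<Longrightarrow> cong J (\<sim> x) (\<sim> y)"
  by (simp add: cong_def neg_diff_neg)

lemma cong_plus_right:
  assumes "x \<in> carrier A" "y \<in> carrier A" "z \<in> carrier A" "cong J x y"
  shows "cong J (x \<oplus> z) (y \<oplus> z)"
  using assms plus_diff_plus_le[of x y z] plus_diff_plus_le[of y x z] proper_idealD(6)[OF J]
  by (auto simp: cong_def)

lemma cong_plus:
  assumes "x \<in> carrier A" "y \<in> carrier A" "z \<in> carrier A" "w \<in> carrier A" "cong J x y" "cong J z w"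
  shows "cong J (x \<oplus> z) (y \<oplus> w)"
  using assms cong_plus_right[of x y z] cong_plus_right[of z w y]
    cong_trans[of "x \<oplus> z" "y \<oplus> z" "y \<oplus> w"] by (simp add: plus_comm)

lemma rep: "x \<in> carrier A \<Longrightarrow> rep J x \<in> carrier A \<and> cong J x (rep J x)"
  unfolding rep_def by (rule someI_ex) (use cong_refl in blast)

lemma rep_closed [simp]: "x \<in> carrier A \<Longrightarrow> rep J x \<in> carrier A"
  using rep by blast

lemma rep_eq:
  assumes "x \<in> carrier A" "y \<in> carrier A" "cong J x y"
  shows "rep J x = rep J y"
proof -
  have "cong J x z \<longleftrightarrow> cong J y z" if "z \<in> carrier A" for z
    using assms that cong_sym cong_trans by blast
  then show ?thesis unfolding rep_def by metis
qed

lemma quot_ops: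
  "carrier (quot J) = rep J ` carrier A" "\<zero>\<^bsub>quot J\<^esub> = rep J \<zero>"
  "\<And>x y. x \<in> carrier A \<Longrightarrow> y \<in> carrier A \<Longrightarrow> rep J x \<oplus>\<^bsub>quot J\<^esub> rep J y = rep J (x \<oplus> y)"
  "\<And>x. x \<in> carrier A \<Longrightarrow> \<sim>\<^bsub>quot J\<^esub> (rep J x) = rep J (\<sim> x)"
proof -
  show "rep J x \<oplus>\<^bsub>quot J\<^esub> rep J y = rep J (x \<oplus> y)" if "x \<in> carrier A" "y \<in> carrier A" for x y
    using that rep[of x] rep[of y] cong_sym by (simp add: quot_def) (intro rep_eq cong_plus; simp)
  show "\<sim>\<^bsub>quot J\<^esub> (rep J x) = rep J (\<sim> x)" if "x \<in> carrier A" for x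
    using that rep[of x] cong_sym by (simp add: quot_def) (intro rep_eq cong_neg; simp)
qed (simp_all add: quot_def)

lemma rep_zero_neq: "rep J (\<sim> \<zero>) \<noteq> rep J \<zero>"
proof
  assume "rep J (\<sim> \<zero>) = rep J \<zero>"
  then have "cong J (\<sim> \<zero>) \<zero>"
    using rep[of \<zero>] rep[of "\<sim> \<zero>"] cong_sym cong_trans[of "\<sim> \<zero>" "rep J \<zero>" \<zero>] by simp
  then show False
    using proper_idealD(3)[OF J] by (simp add: cong_def diff_def)
qed

lemma mv_algebra_quot: "mv_algebra (quot J)"
proof (rule mv_algebra.intro)
  show "comm_monoid \<lparr>carrier = carrier (quot J), mult = mv_plus (quot J), one = \<zero>\<^bsub>quot J\<^esub>\<rparr>"
  proof (rule comm_monoidI, goal_cases)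
    case 5
    then show ?case using plus_comm by (fastforce simp: quot_ops)
  qed (auto simp: quot_ops plus_assoc)
  have "rep J (\<sim> \<zero>) \<in> carrier (quot J)" by (simp add: quot_ops)
  then show "carrier (quot J) \<noteq> {\<zero>\<^bsub>quot J\<^esub>}"
    using rep_zero_neq by (auto simp: quot_ops)
  show "\<sim>\<^bsub>quot J\<^esub> (\<sim>\<^bsub>quot J\<^esub> x \<oplus>\<^bsub>quot J\<^esub> y) \<oplus>\<^bsub>quot J\<^esub> y = \<sim>\<^bsub>quot J\<^esub> (\<sim>\<^bsub>quot J\<^esub> y \<oplus>\<^bsub>quot J\<^esub> x) \<oplus>\<^bsub>quot J\<^esub> x"
    if "x \<in> carrier (quot J)" "y \<in> carrier (quot J)" for x y
    using that lukasiewicz by (auto simp: quot_ops)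
qed (auto simp: quot_ops)

lemma rep_hom: "rep J \<in> mv_hom A (quot J)"
  by (auto simp: mv_hom_def quot_ops)

end

lemma mv_chain_quot:
  assumes M: "maximal_proper M"
  shows "mv_chain (quot M)"
proof -
  have J: "proper_ideal M" using M by (simp add: maximal_proper_def)
  interpret Q: mv_algebra "quot M" by (rule mv_algebra_quot[OF J])
  have le: "Q.le (rep M x) (rep M y)" if "x \<in> carrier A" "y \<in> carrier A" "x \<ominus> y \<in> M" for x y
  proof -
    \<comment> \<open>Subtracting \<sim> x \<oplus> y from the top leaves x \<ominus> y, which is in
      M.\<close>
    have "cong M (\<sim> x \<oplus> y) (\<sim> \<zero>)"
      using that proper_idealD(2)[OF J] by (simp add: cong_def diff_def)
    then show ?thesis
      using that J by (simp add: Q.le_def quot_ops rep_eq[OF J, of "\<sim> x \<oplus> y" "\<sim> \<zero>"])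
  qed
  show ?thesis
  proof
    fix x y assume "x \<in> carrier (quot M)" "y \<in> carrier (quot M)"
    then obtain a b where "a \<in> carrier A" "b \<in> carrier A" "x = rep M a" "y = rep M b"
      by (auto simp: quot_ops[OF J])
    then show "Q.le x y \<or> Q.le y x" using le maximal_proper_prime[OF M] by metis
  qed
qed

lemma mv_hom_compose:
  "g \<in> mv_hom A B \<Longrightarrow> h \<in> mv_hom B C \<Longrightarrow> (\<lambda>x. h (g x)) \<in> mv_hom A C"
  by (auto simp: mv_hom_def Pi_iff)

section \<open>Characters correspond to maximal ideals\<close>

abbreviation character :: "('a \<Rightarrow> real) \<Rightarrow> bool" where
  "character \<phi> \<equiv> (\<phi> \<in> mv_hom A unit_interval)"

abbreviation ker :: "('a \<Rightarrow> real) \<Rightarrow> 'a set" where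
  "ker \<equiv> mv_kernel A unit_interval"

lemma characterD:
  assumes "character \<phi>"
  shows "\<phi> \<zero> = 0" "x \<in> carrier A \<Longrightarrow> 0 \<le> \<phi> x" "x \<in> carrier A \<Longrightarrow> \<phi> x \<le> 1"
    "x \<in> carrier A \<Longrightarrow> y \<in> carrier A \<Longrightarrow> \<phi> (x \<oplus> y) = min 1 (\<phi> x + \<phi> y)"
    "x \<in> carrier A \<Longrightarrow> \<phi> (\<sim> x) = 1 - \<phi> x"
  using assms by (auto simp: mv_hom_def)

lemma in_ker_iff: "x \<in> ker \<phi> \<longleftrightarrow> x \<in> carrier A \<and> \<phi> x = 0"
  by (simp add: mv_kernel_def)

text \<open>The density could vanish on more than the zero class, so only M \<subseteq> ker is
  checked directly; the kernel is a proper ideal, and maximality of M forces equality.\<close>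

lemma maximal_proper_imp_character:
  assumes M: "maximal_proper M"
  obtains \<phi> where "character \<phi>" "ker \<phi> = M"
proof -
  have J: "proper_ideal M" using M by (simp add: maximal_proper_def)
  interpret Q: mv_chain "quot M" by (rule mv_chain_quot[OF M])
  let ?\<phi> = "\<lambda>x. Q.density (rep M x)"
  have \<phi>: "character ?\<phi>"
    by (rule mv_hom_compose[OF rep_hom[OF J] Q.density_hom])
  have "M \<subseteq> ker ?\<phi>"
  proof
    fix x assume x: "x \<in> M"
    then have xc: "x \<in> carrier A" using proper_idealD[OF J] by blast
    then have "cong M x \<zero>"
      using x proper_idealD(2)[OF J] by (simp add: cong_def diff_def)
    then have "rep M x = \<zero>\<^bsub>quot M\<^esub>" using rep_eq[OF J xc zero_closed] quot_ops(2)[OF J] by simp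
    then show "x \<in> ker ?\<phi>" using xc Q.density_zero by (simp add: in_ker_iff)
  qed
  then have "ker ?\<phi> = M"
    using M proper_ideal_kernel[OF mv_algebra_unit_interval \<phi>] by (simp add: maximal_proper_def)
  then show ?thesis using that \<phi> by blast
qed

text \<open>Archimedean argument: if a larger ideal contains a with \<phi> a > 0, some multiple
  \<open>m n\<close> of a has value 1, its complement lies in the kernel, and the two add up to the
  top.\<close>

lemma character_imp_maximal_proper:
  assumes \<phi>: "character \<phi>"
  shows "maximal_proper (ker \<phi>)"
proof -
  note D = characterD[OF \<phi>]
  have "I \<subseteq> ker \<phi>" if I: "proper_ideal I" "ker \<phi> \<subseteq> I" for I
  proof (rule subsetI, rule ccontr)
    fix a assume a: "a \<in> I" "a \<notin> ker \<phi>"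
    note ID = proper_idealD[OF I(1)]
    have ac: "a \<in> carrier A" using ID(4) a(1) .
    have "\<phi> a > 0" using a ac D(2)[OF ac] by (auto simp: in_ker_iff)
    then obtain n :: nat where n: "1 < n * \<phi> a" using reals_Archimedean3 by metis
    define m where "m k = ((\<lambda>x. a \<oplus> x) ^^ k) \<zero>" for k
    have m: "m k \<in> I \<and> \<phi> (m k) = min 1 (k * \<phi> a)" for k
    proof (induction k)
      case 0
      then show ?case using D(1) ID(2) by (simp add: m_def)
    next
      case (Suc k)
      then have "m k \<in> carrier A" "m (Suc k) = a \<oplus> m k"
        using ID(4) by (auto simp: m_def)
      then show ?case
        using Suc a(1) ac ID(5) D(2)[OF ac] D(4)[of a "m k"] by (simp add: min_def algebra_simps)
    qed
    have mc: "m n \<in> carrier A" using m ID(4) by blast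
    have "\<phi> (m n) = 1" using m[of n] n by simp
    then have "\<sim> (m n) \<in> ker \<phi>" using mc D(5) by (simp add: in_ker_iff)
    then have "\<sim> (m n) \<oplus> m n \<in> I" using I(2) m ID(5) by blast
    then show False using mc ID(3) by simp
  qed
  then show ?thesis
    using proper_ideal_kernel[OF mv_algebra_unit_interval \<phi>] by (auto simp: maximal_proper_def)
qed

text \<open>The two notions of maximality range over different families. They agree because every
  kernel is an order ideal and every maximal order ideal is the kernel of a character, so extending
  M by Zorn stays among kernels.\<close>

lemma max_ideals_eq: "max_ideals A = {M. maximal_proper M}"
proof -
  have proper: "proper_ideal I" if "mv_ideal A I" for I
    using that proper_ideal_kernel by (auto simp: mv_ideal_def)
  have ideal: "mv_ideal A M" if "maximal_proper M" for M
    using that maximal_proper_imp_character mv_ideal_kernel[OF mv_algebra_axioms mv_algebra_unit_interval]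
    by metis
  show ?thesis
  proof safe
    fix M assume M: "M \<in> max_ideals A"
    then obtain M' where "maximal_proper M'" "M \<subseteq> M'"
      using proper ex_maximal_proper by (auto simp: max_ideals_def)
    then show "maximal_proper M" using M ideal by (auto simp: max_ideals_def)
  next
    fix M assume "maximal_proper M"
    then show "M \<in> max_ideals A"
      using ideal[of M] proper unfolding max_ideals_def maximal_proper_def by blast
  qed
qed

lemma max_ideals_iff: "M \<in> max_ideals A \<longleftrightarrow> (\<exists>\<phi>. character \<phi> \<and> M = ker \<phi>)"
proof
  assume "M \<in> max_ideals A"
  then have "maximal_proper M" by (simp add: max_ideals_eq)
  then show "\<exists>\<phi>. character \<phi> \<and> M = ker \<phi>"
    using maximal_proper_imp_character[of M] by blast
next
  assume "\<exists>\<phi>. character \<phi> \<and> M = ker \<phi>"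
  then show "M \<in> max_ideals A"
    using character_imp_maximal_proper max_ideals_eq by blast
qed

end

section \<open>The maximal spectral space\<close>

context mv_algebra
begin

section \<open>Supports as a basis of open sets\<close>

definition supp :: "'a \<Rightarrow> 'a set set" where
  "supp a = {M \<in> max_ideals A. a \<notin> M}"

lemma max_spectrum_eq: "max_spectrum A = topology_generated_by (supp ` carrier A)"
proof -
  have "{max_ideals A - {M \<in> max_ideals A. a \<in> M} |a. a \<in> carrier A} = supp ` carrier A"
    by (auto simp: supp_def)
  then show ?thesis by (simp add: max_spectrum_def)
qed

lemma openin_supp: "a \<in> carrier A \<Longrightarrow> openin (max_spectrum A) (supp a)"
  by (simp add: max_spectrum_eq topology_generated_by_Basis)

lemma topspace_max [simp]: "topspace (max_spectrum A) = max_ideals A"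
  by (rule topspace_max_spectrum[OF mv_algebra_axioms])

lemma character_diff:
  assumes "character \<phi>" "x \<in> carrier A" "y \<in> carrier A"
  shows "\<phi> (x \<ominus> y) = max 0 (\<phi> x - \<phi> y)"
  using characterD(4,5)[OF assms(1)] assms(2,3) by (simp add: diff_def min_def max_def)

lemma character_mul:
  assumes "character \<phi>" "x \<in> carrier A" "y \<in> carrier A"
  shows "\<phi> (x \<odot> y) = max 0 (\<phi> x + \<phi> y - 1)"
  using characterD(4,5)[OF assms(1)] assms(2,3) by (simp add: mul_def min_def max_def)

text \<open>A minimum of two numbers in [0,1] vanishes exactly if one of them does. Closure under
  intersection turns the generating family into a basis.\<close>

lemma supp_meet:
  assumes "a \<in> carrier A" "b \<in> carrier A"
  shows "supp (meet a b) = supp a \<inter> supp b"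
proof -
  have "meet a b \<in> ker \<phi> \<longleftrightarrow> a \<in> ker \<phi> \<or> b \<in> ker \<phi>" if "character \<phi>" for \<phi>
    using that assms characterD(2)[OF that]
    by (simp add: in_ker_iff meet_def character_diff) (smt (verit, best))
  then show ?thesis by (auto simp: supp_def max_ideals_iff)
qed

lemma max_spectrum_basis:
  assumes "openin (max_spectrum A) s" "M \<in> s"
  obtains a where "a \<in> carrier A" "M \<in> supp a" "supp a \<subseteq> s"
proof -
  have "generate_topology_on (supp ` carrier A) s"
    using assms by (simp add: max_spectrum_eq openin_topology_generated_by_iff)
  then have "\<forall>M\<in>s. \<exists>a\<in>carrier A. M \<in> supp a \<and> supp a \<subseteq> s"
  proof induction
    case (Int s t)
    show ?case
    proof
      fix M assume M: "M \<in> s \<inter> t"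
      then obtain a b where "a \<in> carrier A" "M \<in> supp a" "supp a \<subseteq> s"
        "b \<in> carrier A" "M \<in> supp b" "supp b \<subseteq> t" using Int.IH by blast
      then show "\<exists>c\<in>carrier A. M \<in> supp c \<and> supp c \<subseteq> s \<inter> t"
        by (intro bexI[of _ "meet a b"]) (auto simp: supp_meet)
    qed
  next
    case (UN K)
    then show ?case by (meson Union_iff Union_upper subset_trans)
  qed auto
  then show ?thesis using assms that by blast
qed

section \<open>Compactness of the spectral space\<close>

definition total :: "'a list \<Rightarrow> 'a" where "total xs = foldr (\<oplus>) xs \<zero>"

lemma total_closed: "set xs \<subseteq> carrier A \<Longrightarrow> total xs \<in> carrier A"
  by (induction xs) (auto simp: total_def)

lemma total_append:
  "set xs \<subseteq> carrier A \<Longrightarrow> set ys \<subseteq> carrier A \<Longrightarrow> total (xs @ ys) = total xs \<oplus> total ys"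
  by (induction xs) (auto simp: total_def plus_assoc total_closed[unfolded total_def])

lemma total_in_ideal:
  assumes J: "proper_ideal J"
  shows "set xs \<subseteq> J \<Longrightarrow> total xs \<in> J"
  by (induction xs) (simp_all add: total_def proper_idealD(2,5)[OF J])

text \<open>Compactness in algebraic form: the ideal generated by S is proper unless some finite sum
  from S reaches the top. The sums run over lists because repeated summands count.\<close>

lemma ex_max_ideal_or_total_eq_top:
  assumes S: "S \<subseteq> carrier A"
  shows "(\<exists>M\<in>max_ideals A. S \<subseteq> M) \<or> (\<exists>xs. set xs \<subseteq> S \<and> total xs = \<sim> \<zero>)"
proof (rule disjCI)
  assume no: "\<nexists>xs. set xs \<subseteq> S \<and> total xs = \<sim> \<zero>"
  let ?I = "{x \<in> carrier A. \<exists>xs. set xs \<subseteq> S \<and> x \<preceq> total xs}"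
  have tc: "total xs \<in> carrier A" if "set xs \<subseteq> S" for xs
    using that S by (intro total_closed) auto
  have "proper_ideal ?I"
  proof (rule proper_idealI)
    show "?I \<subseteq> carrier A" by blast
    show "\<zero> \<in> ?I" by (auto intro!: exI[of _ "[]"] simp: total_def)
    show "\<sim> \<zero> \<notin> ?I"
    proof
      assume "\<sim> \<zero> \<in> ?I"
      then obtain xs where xs: "set xs \<subseteq> S" "\<sim> \<zero> \<preceq> total xs" by blast
      then show False using no tc[OF xs(1)] top_le by blast
    qed
    show "x \<oplus> y \<in> ?I" if xy: "x \<in> ?I" "y \<in> ?I" for x y
    proof -
      obtain xs ys where *: "set xs \<subseteq> S" "x \<preceq> total xs" "set ys \<subseteq> S" "y \<preceq> total ys"
        "x \<in> carrier A" "y \<in> carrier A"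
        using xy by blast
      then have "x \<oplus> y \<preceq> total xs \<oplus> total ys" using tc by (intro plus_mono) auto
      also have "\<dots> = total (xs @ ys)" using * S by (simp add: total_append subset_trans)
      finally show ?thesis using * by (auto intro!: exI[of _ "xs @ ys"])
    qed
    show "y \<in> ?I" if "x \<in> ?I" "y \<in> carrier A" "y \<preceq> x" for x y
      using that le_trans[of y x] tc by blast
  qed
  then obtain M where M: "maximal_proper M" "?I \<subseteq> M" by (rule ex_maximal_proper)
  have "S \<subseteq> ?I"
  proof
    fix x assume "x \<in> S"
    then show "x \<in> ?I" using S by (auto intro!: exI[of _ "[x]"] simp: total_def)
  qed
  then have "S \<subseteq> M" using M(2) by (rule subset_trans)
  then show "\<exists>M\<in>max_ideals A. S \<subseteq> M" using M(1) max_ideals_eq by blast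
qed

lemma compact_max_spectrum: "compact_space (max_spectrum A)"
  unfolding compact_space_alt
proof (intro allI impI)
  fix \<U> assume \<U>: "(\<forall>U\<in>\<U>. openin (max_spectrum A) U) \<and> topspace (max_spectrum A) \<subseteq> \<Union> \<U>"
  \<comment> \<open>No maximal ideal M contains S, since a member of the cover around M includes a
    basic neighbourhood \<open>supp a\<close> of M. A finite sum from S therefore equals the top,
    and its summands pick a finite subcover.\<close>
  define S where "S = {a \<in> carrier A. \<exists>U\<in>\<U>. supp a \<subseteq> U}"
  have "\<not> S \<subseteq> M" if M: "M \<in> max_ideals A" for M
  proof -
    obtain U where U: "U \<in> \<U>" "M \<in> U" "openin (max_spectrum A) U" using \<U> M by auto
    then obtain a where "a \<in> carrier A" "M \<in> supp a" "supp a \<subseteq> U"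
      by (auto elim: max_spectrum_basis)
    then show ?thesis using U by (auto simp: S_def supp_def)
  qed
  then obtain xs where xs: "set xs \<subseteq> S" "total xs = \<sim> \<zero>"
    using ex_max_ideal_or_total_eq_top[of S] by (auto simp: S_def)
  have "\<forall>a\<in>set xs. \<exists>U\<in>\<U>. supp a \<subseteq> U" using xs by (auto simp: S_def)
  then obtain f where f: "\<And>a. a \<in> set xs \<Longrightarrow> f a \<in> \<U> \<and> supp a \<subseteq> f a" by metis
  have "max_ideals A \<subseteq> \<Union> (f ` set xs)"
  proof
    fix M assume M: "M \<in> max_ideals A"
    then have P: "proper_ideal M" by (simp add: max_ideals_eq maximal_proper_def)
    have "\<not> set xs \<subseteq> M" using total_in_ideal[OF P] xs proper_idealD(3)[OF P] by metis
    then show "M \<in> \<Union> (f ` set xs)" using f M by (auto simp: supp_def)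
  qed
  then show "\<exists>\<F>. finite \<F> \<and> \<F> \<subseteq> \<U> \<and> topspace (max_spectrum A) \<subseteq> \<Union> \<F>"
    using f by (intro exI[of _ "f ` set xs"]) auto
qed

text \<open>The test elements \<open>b\<close> come from iterating the doubling map, \<open>t \<mapsto> min 1 (2 t)\<close> and
  \<open>t \<mapsto> max 0 (2 t - 1)\<close>, which are \<open>a \<oplus> a\<close> and \<open>a \<odot> a\<close> under a character.\<close>
lemma dyadic_test:
  assumes "a \<in> carrier A"
  shows "\<exists>b\<in>carrier A. \<forall>\<phi>. character \<phi> \<longrightarrow> (0 < \<phi> b \<longleftrightarrow> real p / 2 ^ k < \<phi> a)"
  using assms
proof (induction k arbitrary: a p)
  case 0
  show ?case
  proof (cases "p = 0")
    case True
    then show ?thesis using 0 by auto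
  next
    case False
    then have "0 < \<phi> \<zero> \<longleftrightarrow> real p / 2 ^ 0 < \<phi> a" if "character \<phi>" for \<phi>
      using characterD(1)[OF that] characterD(3)[OF that 0] by simp
    then show ?thesis using zero_closed by blast
  qed
next
  case (Suc k)
  show ?case
  proof (cases "p < 2 ^ k")
    case True
    obtain b where b: "b \<in> carrier A"
      "\<And>\<phi>. character \<phi> \<Longrightarrow> 0 < \<phi> b \<longleftrightarrow> real p / 2 ^ k < \<phi> (a \<oplus> a)"
      using Suc.IH[OF plus_closed[OF Suc.prems Suc.prems], of p] by blast
    have "real p < real (2 ^ k)" using True of_nat_less_iff by blast
    then have "real p / 2 ^ k < 1" by simp
    then have "real p / 2 ^ k < \<phi> (a \<oplus> a) \<longleftrightarrow> real p / 2 ^ Suc k < \<phi> a" if "character \<phi>" for \<phi>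
      using characterD(4)[OF that Suc.prems Suc.prems] by (auto simp: field_simps)
    then show ?thesis using b by blast
  next
    case False
    obtain b where b: "b \<in> carrier A"
      "\<And>\<phi>. character \<phi> \<Longrightarrow> 0 < \<phi> b \<longleftrightarrow> real (p - 2 ^ k) / 2 ^ k < \<phi> (a \<odot> a)"
      using Suc.IH[OF mul_closed[OF Suc.prems Suc.prems], of "p - 2 ^ k"] by blast
    have "real (p - 2 ^ k) / 2 ^ k = real p / 2 ^ k - 1"
      using False by (simp add: of_nat_diff diff_divide_distrib)
    moreover have "0 \<le> real (p - 2 ^ k) / 2 ^ k" by simp
    ultimately have "real (p - 2 ^ k) / 2 ^ k < \<phi> (a \<odot> a) \<longleftrightarrow> real p / 2 ^ k < 2 * \<phi> a"
      if "character \<phi>" for \<phi>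
      using character_mul[OF that Suc.prems Suc.prems] by linarith
    moreover have "real p / 2 ^ k < 2 * t \<longleftrightarrow> real p / 2 ^ Suc k < t" for t :: real
      by (simp add: field_simps)
    ultimately have "real (p - 2 ^ k) / 2 ^ k < \<phi> (a \<odot> a) \<longleftrightarrow> real p / 2 ^ Suc k < \<phi> a"
      if "character \<phi>" for \<phi>
      using that by blast
    then show ?thesis using b by blast
  qed
qed

lemma ex_dyadic_between:
  fixes c t :: real
  assumes "0 \<le> c" "c < t"
  obtains p k :: nat where "c \<le> real p / 2 ^ k" "real p / 2 ^ k < t"
proof -
  obtain k where k: "(1/2) ^ k < t - c"
    using real_arch_pow_inv[of "t - c" "1/2"] assms by auto
  \<comment> \<open>Rounding c up to the grid of mesh 1 / 2 ^ k moves it by less than t - c; nat is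
    harmless because c \<ge> 0.\<close>
  let ?p = "nat \<lceil>c * 2 ^ k\<rceil>"
  have "real ?p = of_int \<lceil>c * 2 ^ k\<rceil>" using assms by simp
  then have "c * 2 ^ k \<le> real ?p" "real ?p < c * 2 ^ k + 1" by linarith+
  then have "c \<le> real ?p / 2 ^ k" "real ?p / 2 ^ k < c + (1/2) ^ k"
    by (simp_all add: field_simps)
  then show ?thesis using that k by force
qed

section \<open>The character of a maximal ideal and the continuity of its values\<close>

definition char_of :: "'a set \<Rightarrow> 'a \<Rightarrow> real" where
  "char_of M = (SOME \<phi>. character \<phi> \<and> ker \<phi> = M)"

lemma char_of:
  assumes "M \<in> max_ideals A"
  shows "character (char_of M)" "ker (char_of M) = M"
proof -
  obtain \<phi> where "character \<phi> \<and> ker \<phi> = M" using assms max_ideals_iff by auto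
  then have "character (char_of M) \<and> ker (char_of M) = M"
    unfolding char_of_def by (rule someI[where P = "\<lambda>\<phi>. character \<phi> \<and> ker \<phi> = M"])
  then show "character (char_of M)" "ker (char_of M) = M" by auto
qed

lemma char_of_pos_iff:
  assumes "M \<in> max_ideals A" "b \<in> carrier A"
  shows "0 < char_of M b \<longleftrightarrow> M \<in> supp b"
proof -
  have "b \<in> M \<longleftrightarrow> char_of M b = 0"
    using in_ker_iff[of b "char_of M"] assms(2) unfolding char_of(2)[OF assms(1)] by simp
  moreover have "0 \<le> char_of M b"
    by (rule characterD(2)[OF char_of(1)[OF assms(1)] assms(2)])
  ultimately show ?thesis using assms(1) unfolding supp_def by auto
qed

text \<open>A dyadic threshold between c and the value at M is converted by
  \<open>dyadic_test\<close> into the support of a single element. For c < 0 the set is the whole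
  space.\<close>

lemma openin_char_of_greater:
  assumes a: "a \<in> carrier A"
  shows "openin (max_spectrum A) {M \<in> max_ideals A. c < char_of M a}"
proof (subst openin_subopen, safe)
  fix M assume M: "M \<in> max_ideals A" "c < char_of M a"
  show "\<exists>T. openin (max_spectrum A) T \<and> M \<in> T \<and> T \<subseteq> {M \<in> max_ideals A. c < char_of M a}"
  proof (cases "0 \<le> c")
    case True
    obtain p k :: nat where pk: "c \<le> real p / 2 ^ k" "real p / 2 ^ k < char_of M a"
      using ex_dyadic_between[OF True M(2)] by blast
    obtain b where b: "b \<in> carrier A"
      "\<And>\<phi>. character \<phi> \<Longrightarrow> 0 < \<phi> b \<longleftrightarrow> real p / 2 ^ k < \<phi> a"
      using dyadic_test[OF a, of p k] by blast
    have "N \<in> supp b \<longleftrightarrow> real p / 2 ^ k < char_of N a" if "N \<in> max_ideals A" for N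
      using b(2)[OF char_of(1)[OF that]] char_of_pos_iff[OF that b(1)] by blast
    then have "M \<in> supp b" "supp b \<subseteq> {M \<in> max_ideals A. c < char_of M a}"
      using M pk by (auto simp: supp_def)
    then show ?thesis using openin_supp[OF b(1)] by blast
  next
    case False
    then have "c < char_of N a" if "N \<in> max_ideals A" for N
      using characterD(2)[OF char_of(1)[OF that] a] by simp
    then have "{M \<in> max_ideals A. c < char_of M a} = topspace (max_spectrum A)" by auto
    then show ?thesis using M openin_topspace by fastforce
  qed
qed

lemma continuous_map_char_of:
  assumes a: "a \<in> carrier A"
  shows "continuous_map (max_spectrum A) euclideanreal (\<lambda>M. char_of M a)"
proof -
  \<comment> \<open>Negation exchanges sublevel and superlevel sets, so openness from above is
    enough.\<close>
  have "{M \<in> max_ideals A. char_of M a < c} = {M \<in> max_ideals A. 1 - c < char_of M (\<sim> a)}" for c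
    using characterD(5)[OF char_of(1) a] by auto
  then show ?thesis
    using openin_char_of_greater[OF a] openin_char_of_greater[OF neg_closed[OF a]]
    by (simp add: continuous_map_upper_lower_semicontinuous_lt)
qed

section \<open>Surjective endomorphisms\<close>

lemma hopfianI:
  assumes "\<And>h x. \<lbrakk>h \<in> mv_hom A A; h ` carrier A = carrier A; x \<in> carrier A; h x = \<zero>\<rbrakk> \<Longrightarrow> x = \<zero>"
  shows "hopfian A"
  unfolding hopfian_def
proof (intro ballI impI)
  fix h assume h: "h \<in> mv_hom A A" "h ` carrier A = carrier A"
  have hd: "h (x \<ominus> y) = h x \<ominus> h y" if "x \<in> carrier A" "y \<in> carrier A" for x y
    using h(1) that by (auto simp: mv_hom_def diff_def)
  have "x = y" if xy: "x \<in> carrier A" "y \<in> carrier A" "h x = h y" for x y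
  proof -
    have "h x \<in> carrier A" using h xy by blast
    then have "h x \<ominus> h x = \<zero>" by (simp add: diff_def)
    then have "x \<ominus> y = \<zero>" "y \<ominus> x = \<zero>"
      using assms[OF h] hd xy by (metis diff_closed)+
    then show ?thesis using xy by (simp add: diff_eq_zero_iff le_antisym)
  qed
  then have "inj_on h (carrier A)" by (auto simp: inj_on_def)
  then show "h \<in> mv_iso A A" using h by (simp add: mv_iso_def bij_betw_def)
qed

definition pullback :: "('a \<Rightarrow> 'a) \<Rightarrow> 'a set \<Rightarrow> 'a set" where
  "pullback h M = {x \<in> carrier A. h x \<in> M}"

lemma pullback_max_ideal:
  assumes h: "h \<in> mv_hom A A" and M: "M \<in> max_ideals A"
  shows "pullback h M \<in> max_ideals A"
proof -
  obtain \<phi> where "character \<phi>" "M = ker \<phi>" using M max_ideals_iff by blast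
  moreover from this have "pullback h M = ker (\<lambda>x. \<phi> (h x))"
    using h by (auto simp: pullback_def mv_kernel_def mv_hom_def)
  ultimately show ?thesis using max_ideals_iff mv_hom_compose[OF h] by blast
qed

lemma continuous_map_pullback:
  assumes h: "h \<in> mv_hom A A"
  shows "continuous_map (max_spectrum A) (max_spectrum A) (pullback h)"
  unfolding max_spectrum_eq
proof (rule continuous_on_generated_topo)
  fix U assume "U \<in> supp ` carrier A"
  then obtain a where a: "a \<in> carrier A" "U = supp a" by blast
  have "pullback h -` U \<inter> topspace (max_spectrum A) = supp (h a)"
    using a pullback_max_ideal[OF h] by (auto simp: supp_def pullback_def)
  moreover have "h a \<in> carrier A" using h a by (auto simp: mv_hom_def)
  ultimately show "openin (topology_generated_by (supp ` carrier A))
      (pullback h -` U \<inter> topspace (topology_generated_by (supp ` carrier A)))"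
    using openin_supp[of "h a"] by (simp flip: max_spectrum_eq)
next
  have "topspace (max_spectrum A) = \<Union> (supp ` carrier A)"
    by (simp add: max_spectrum_eq del: topspace_max)
  then show "pullback h ` topspace (topology_generated_by (supp ` carrier A)) \<subseteq> \<Union> (supp ` carrier A)"
    using pullback_max_ideal[OF h] by (auto simp flip: max_spectrum_eq)
qed

lemma inj_on_pullback:
  assumes "h ` carrier A = carrier A"
  shows "inj_on (pullback h) (max_ideals A)"
proof (rule inj_onI)
  fix M N assume MN: "M \<in> max_ideals A" "N \<in> max_ideals A" "pullback h M = pullback h N"
  have "M \<subseteq> carrier A" "N \<subseteq> carrier A"
    using MN proper_idealD(1) by (auto simp: max_ideals_eq maximal_proper_def)
  moreover have "L = h ` pullback h L" if "L \<subseteq> carrier A" for L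
    using that assms by (auto simp: pullback_def image_iff)
  ultimately show "M = N" using MN(3) by metis
qed

text \<open>Every pullback contains the kernel of h. If all maximal ideals are pullbacks, the kernel
  lies in their intersection, which is {0}.\<close>

lemma hopfian_if_pullbacks_surj:
  assumes ss: "semisimple A"
    and surj: "\<And>h. \<lbrakk>h \<in> mv_hom A A; h ` carrier A = carrier A\<rbrakk>
      \<Longrightarrow> pullback h ` max_ideals A = max_ideals A"
  shows "hopfian A"
proof (rule hopfianI)
  fix h x assume h: "h \<in> mv_hom A A" "h ` carrier A = carrier A" and x: "x \<in> carrier A" "h x = \<zero>"
  have "x \<in> M" if M: "M \<in> max_ideals A" for M
  proof -
    obtain N where "N \<in> max_ideals A" "M = pullback h N" using surj[OF h] M by blast
    moreover from this have "\<zero> \<in> N"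
      using proper_idealD(2) by (auto simp: max_ideals_eq maximal_proper_def)
    ultimately show ?thesis using x by (simp add: pullback_def)
  qed
  then show "x = \<zero>" using ss by (auto simp: semisimple_def)
qed

section \<open>Characters determined by their values on generators\<close>

lemma characters_agree:
  assumes S: "S \<subseteq> carrier A" "mv_generate A S = carrier A"
    and \<psi>: "character \<psi>" and \<eta>: "character \<eta>"
    and eq: "\<forall>s\<in>S. \<psi> s = \<eta> s" and a: "a \<in> carrier A"
  shows "\<psi> a = \<eta> a"
proof -
  have "a \<in> mv_generate A S" using a S by simp
  then have "a \<in> carrier A \<and> \<psi> a = \<eta> a"
    by induction (use eq S(1) characterD(1,4,5)[OF \<psi>] characterD(1,4,5)[OF \<eta>] in auto)
  then show ?thesis by simp
qed

text \<open>Malcev's argument: \<open>\<phi> \<mapsto> \<phi> \<circ> h\<close> permutes the finitely many characters with values in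
  \<open>(1/d)\<int>\<close>, so all of them vanish on the kernel of \<open>h\<close>.\<close>
lemma hopfian_if_residually_finite:
  assumes S: "S \<subseteq> carrier A" "finite S" "mv_generate A S = carrier A"
    and sep: "\<And>a. \<lbrakk>a \<in> carrier A; a \<noteq> \<zero>\<rbrakk>
      \<Longrightarrow> \<exists>\<phi>. character \<phi> \<and> \<phi> a \<noteq> 0 \<and> (\<forall>s\<in>S. \<phi> s \<in> \<rat>)"
  shows "hopfian A"
proof (rule hopfianI, rule ccontr)
  fix h x
  assume h: "h \<in> mv_hom A A" "h ` carrier A = carrier A" and x: "x \<in> carrier A" "h x = \<zero>" "x \<noteq> \<zero>"
  obtain \<phi> where \<phi>: "character \<phi>" "\<phi> x \<noteq> 0" "\<forall>s\<in>S. \<phi> s \<in> \<rat>" using sep x by blast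
  obtain d :: nat where d: "d > 0" "\<forall>s\<in>S. real d * \<phi> s \<in> \<int>"
  proof -
    have "\<exists>d>0. \<forall>s\<in>S. real d * \<phi> s \<in> \<int>" using \<open>finite S\<close> \<phi>(3)
    proof (induction S)
      case empty
      then show ?case by auto
    next
      case (insert s S)
      then obtain d where d: "d > 0" "\<forall>s\<in>S. real d * \<phi> s \<in> \<int>" by auto
      obtain m :: int and e :: nat where e: "e > 0" "\<phi> s = m / e"
        using insert.prems by (metis Rats_cases' insertI1 zero_less_imp_eq_int of_int_of_nat_eq of_nat_0_less_iff)
      have "real (d * e) * \<phi> t \<in> \<int>" if "t \<in> insert s S" for t
      proof (cases "t = s")
        case True
        then have "real (d * e) * \<phi> t = of_int (int d * m)" using e by simp
        then show ?thesis by (metis Ints_of_int)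
      next
        case False
        then have "real d * \<phi> t \<in> \<int>" using d that by blast
        moreover have "real (d * e) * \<phi> t = real e * (real d * \<phi> t)" by simp
        ultimately show ?thesis by (metis Ints_mult Ints_of_nat)
      qed
      then show ?case using d(1) e(1) by (metis mult_pos_pos)
    qed
    then show ?thesis using that by blast
  qed
  \<comment> \<open>Extensionality makes members that agree on the carrier equal. Hence restriction
    to S is injective on E, and its image lies in the functions from S to the finite grid
    \<open>?V\<close>.\<close>
  define E where "E = {\<psi> \<in> extensional (carrier A). character \<psi> \<and> (\<forall>a\<in>carrier A. real d * \<psi> a \<in> \<int>)}"
  let ?V = "{v \<in> {0..1}. real d * v \<in> \<int>}"
  have "finite ?V"
  proof (rule finite_subset)
    show "?V \<subseteq> (\<lambda>k. real_of_int k / d) ` {0..int d}"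
    proof
      fix v assume v: "v \<in> ?V"
      then obtain k where k: "real d * v = of_int k" by (auto elim: Ints_cases)
      have "0 \<le> real d * v" "real d * v \<le> real d" using v by (auto simp: mult_left_le)
      then have "k \<in> {0..int d}" using k by auto
      moreover have "v = of_int k / d" using k d(1) by (simp add: field_simps)
      ultimately show "v \<in> (\<lambda>k. real_of_int k / d) ` {0..int d}" by blast
    qed
  qed simp
  moreover have "(\<lambda>\<psi>. restrict \<psi> S) ` E \<subseteq> S \<rightarrow>\<^sub>E ?V"
    using S(1) characterD(2,3) by (auto simp: E_def subset_iff)
  moreover note agree = characters_agree[OF S(1,3)]
  have "inj_on (\<lambda>\<psi>. restrict \<psi> S) E"
  proof (rule inj_onI)
    fix \<psi> \<eta> assume *: "\<psi> \<in> E" "\<eta> \<in> E" "restrict \<psi> S = restrict \<eta> S"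
    then have "\<forall>s\<in>S. \<psi> s = \<eta> s" by (metis restrict_apply')
    then show "\<psi> = \<eta>"
      using * agree by (intro extensionalityI[of \<psi> "carrier A"]) (auto simp: E_def)
  qed
  ultimately have "finite E"
    using S(2) finite_PiE by (metis (no_types, lifting) finite_imageD finite_subset)
  let ?T = "\<lambda>\<psi>. restrict (\<lambda>a. \<psi> (h a)) (carrier A)"
  have restrict: "character (restrict \<psi> (carrier A))" if "character \<psi>" for \<psi>
    using that by (auto simp: mv_hom_def)
  have hc: "h a \<in> carrier A" if "a \<in> carrier A" for a using h that by blast
  have "?T ` E \<subseteq> E"
    using restrict[OF mv_hom_compose[OF h(1)]] hc by (auto simp: E_def)
  moreover have "inj_on ?T E"
  proof (rule inj_onI)
    fix \<psi> \<eta> assume *: "\<psi> \<in> E" "\<eta> \<in> E" "?T \<psi> = ?T \<eta>"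
    have "\<psi> b = \<eta> b" if bc: "b \<in> carrier A" for b
    proof -
      obtain a where "a \<in> carrier A" "b = h a" using h(2) bc by blast
      then show ?thesis using *(3) by (metis restrict_apply')
    qed
    then show "\<psi> = \<eta>"
      using * by (intro extensionalityI[of \<psi> "carrier A"]) (auto simp: E_def)
  qed
  ultimately have onto: "?T ` E = E"
    using \<open>finite E\<close> by (simp add: endo_inj_surj)
  \<comment> \<open>The multiples of 1 / d in [0,1] contain 0 and 1 and are closed under truncated
    sum and complement, so the values of \<phi> stay in this grid.\<close>
  have "real d * \<phi> a \<in> \<int>" if "a \<in> carrier A" for a
  proof -
    have "a \<in> mv_generate A S" using that S by simp
    then have "a \<in> carrier A \<and> real d * \<phi> a \<in> \<int>"
    proof induction
      case zero
      then show ?case using characterD(1)[OF \<phi>(1)] by simp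
    next
      case (incl s)
      then show ?case using d S by auto
    next
      case (plus a b)
      then have "real d * \<phi> (a \<oplus> b) = min (real d) (real d * \<phi> a + real d * \<phi> b)"
        using characterD(4)[OF \<phi>(1), of a b] d(1)
        by (simp add: min_mult_distrib_left distrib_left)
      then show ?case using plus by (simp add: min_def)
    next
      case (neg a)
      then show ?case using characterD(5)[OF \<phi>(1)] by (simp add: right_diff_distrib)
    qed
    then show ?thesis by simp
  qed
  then have "restrict \<phi> (carrier A) \<in> E" using restrict[OF \<phi>(1)] by (simp add: E_def)
  then obtain \<psi> where \<psi>: "\<psi> \<in> E" "restrict \<phi> (carrier A) = ?T \<psi>" using onto by blast
  then have "\<phi> x = \<psi> (h x)" using x(1) by (metis restrict_apply')
  also have "\<dots> = 0" using x(2) characterD(1) \<psi>(1) by (simp add: E_def)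
  finally show False using \<phi>(2) by simp
qed

end

section \<open>Invariance of domain\<close>

text \<open>V is any open set rather than a ball, so that open subsets of patches are patches
  again.\<close>

definition euclidean_patch :: "nat \<Rightarrow> 'a topology \<Rightarrow> 'a set \<Rightarrow> bool" where
  "euclidean_patch n X W \<longleftrightarrow> openin X W \<and>
     (\<exists>V. openin (Euclidean_space n) V \<and>
       subtopology X W homeomorphic_space subtopology (Euclidean_space n) V)"

lemma open_subset_of_chart:
  assumes hom: "subtopology X U homeomorphic_space subtopology Y V"
    and U: "openin X U" and V: "openin Y V" and W: "openin X W" "W \<subseteq> U"
  obtains V' where "openin Y V'" "subtopology X W homeomorphic_space subtopology Y V'"
proof -
  obtain f where f: "homeomorphic_map (subtopology X U) (subtopology Y V) f"
    using hom homeomorphic_space by blast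
  have top: "topspace (subtopology X U) = U" using U openin_subset by auto
  have "openin (subtopology X U) W" using W by (simp add: openin_open_subtopology U)
  then have fW: "openin (subtopology Y V) (f ` W)"
    using homeomorphic_map_openness[OF f, of W] W(2) unfolding top by blast
  then have "openin Y (f ` W)" using V openin_trans_full by blast
  moreover have "homeomorphic_map (subtopology (subtopology X U) W) (subtopology (subtopology Y V) (f ` W)) f"
  proof (rule homeomorphic_map_subtopologies[OF f])
    show "f ` (topspace (subtopology X U) \<inter> W) = topspace (subtopology Y V) \<inter> f ` W"
      using W(2) openin_subset[OF fW] unfolding top by blast
  qed
  then have "homeomorphic_map (subtopology X W) (subtopology Y (f ` W)) f"
    using W(2) openin_subset[OF fW]
    by (simp add: subtopology_subtopology Int_absorb1)
  ultimately show ?thesis using that homeomorphic_map_imp_homeomorphic_space by blast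
qed

lemma euclidean_patch_subset:
  assumes "euclidean_patch n X U" "openin X W" "W \<subseteq> U"
  shows "euclidean_patch n X W"
proof -
  obtain V where "openin X U" "openin (Euclidean_space n) V"
    "subtopology X U homeomorphic_space subtopology (Euclidean_space n) V"
    using assms(1) by (auto simp: euclidean_patch_def)
  then obtain V' where "openin (Euclidean_space n) V'"
    "subtopology X W homeomorphic_space subtopology (Euclidean_space n) V'"
    using open_subset_of_chart assms(2,3) by metis
  then show ?thesis using assms(2) by (auto simp: euclidean_patch_def)
qed

lemma euclidean_patch_open_subtopology:
  assumes "euclidean_patch n (subtopology X U) W" "openin X U"
  shows "euclidean_patch n X W"
proof -
  have W: "openin (subtopology X U) W" using assms(1) by (simp add: euclidean_patch_def)
  then have "subtopology (subtopology X U) W = subtopology X W"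
    using openin_subset[OF W] by (simp add: subtopology_subtopology Int_absorb1)
  then show ?thesis
    using assms openin_trans_full[OF W assms(2)] by (simp add: euclidean_patch_def)
qed

text \<open>Invariance of domain, applied to k after the inverse chart.\<close>

lemma euclidean_patch_image_open:
  assumes patch: "euclidean_patch n X W"
    and k: "continuous_map (subtopology X W) (Euclidean_space n) k" "inj_on k W"
  shows "openin (Euclidean_space n) (k ` W)"
proof -
  obtain V where W: "openin X W" and V: "openin (Euclidean_space n) V"
    and "subtopology X W homeomorphic_space subtopology (Euclidean_space n) V"
    using patch by (auto simp: euclidean_patch_def)
  then obtain f g where fg: "homeomorphic_maps (subtopology X W) (subtopology (Euclidean_space n) V) f g"
    by (auto simp: homeomorphic_space_def)
  have top: "topspace (subtopology X W) = W" "topspace (subtopology (Euclidean_space n) V) = V"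
    using W V openin_subset by auto
  have gim: "g \<in> V \<rightarrow> W" "f \<in> W \<rightarrow> V"
    using fg unfolding homeomorphic_maps_def continuous_map_def top by blast+
  have gf: "\<And>x. x \<in> W \<Longrightarrow> g (f x) = x" "\<And>y. y \<in> V \<Longrightarrow> f (g y) = y"
    using fg unfolding homeomorphic_maps_def top by blast+
  have "openin (Euclidean_space n) ((k \<circ> g) ` V)"
  proof (rule invariance_of_domain_Euclidean_space[OF V])
    show "continuous_map (subtopology (Euclidean_space n) V) (Euclidean_space n) (k \<circ> g)"
      using fg k(1) continuous_map_compose by (auto simp: homeomorphic_maps_def)
    show "inj_on (k \<circ> g) V"
      using gim gf(2) by (intro comp_inj_on inj_on_subset[OF k(2)]) (auto intro: inj_on_inverseI)
  qed
  moreover have "g ` V = W" using gim gf(1) by force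
  ultimately show ?thesis by (simp flip: image_image)
qed

section \<open>Compact manifolds without boundary\<close>

lemma manifold_patch:
  assumes "manifold_without_boundary n X" "p \<in> topspace X"
  obtains U where "p \<in> U" "euclidean_patch n X U"
  using assms unfolding manifold_without_boundary_def locally_homeomorphic_to_def euclidean_patch_def
  by metis

lemma manifold_inj_open_map:
  assumes mf: "manifold_without_boundary n X"
    and f: "continuous_map X X f" "inj_on f (topspace X)"
  shows "open_map X X f"
  unfolding open_map_def
proof (intro allI impI)
  fix U assume U: "openin X U"
  show "openin X (f ` U)"
  proof (subst openin_subopen, safe)
    fix p assume p: "p \<in> U"
    then have pX: "p \<in> topspace X" using U openin_subset by blast
    obtain U1 where U1: "p \<in> U1" "euclidean_patch n X U1" using manifold_patch[OF mf pX] .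
    have "f p \<in> topspace X" using f pX by (auto simp: continuous_map_def)
    then obtain U2 where U2: "f p \<in> U2" "euclidean_patch n X U2" by (rule manifold_patch[OF mf])
    obtain V2 where V2: "openin X U2" "openin (Euclidean_space n) V2"
      "subtopology X U2 homeomorphic_space subtopology (Euclidean_space n) V2"
      using U2(2) by (auto simp: euclidean_patch_def)
    then obtain g where g: "homeomorphic_map (subtopology X U2) (subtopology (Euclidean_space n) V2) g"
      using homeomorphic_space by blast
    \<comment> \<open>Shrunk so that both W and its image lie in charts; read through them, f
      becomes an injective map between open sets of the same Euclidean space.\<close>
    define W where "W = U \<inter> U1 \<inter> {x \<in> topspace X. f x \<in> U2}"
    have Wop: "openin X W"
      unfolding W_def using U U1 V2 openin_continuous_map_preimage[OF f(1)]
      by (auto simp: euclidean_patch_def)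
    have W: "euclidean_patch n X W"
      by (rule euclidean_patch_subset[OF U1(2) Wop]) (auto simp: W_def)
    have top2: "topspace (subtopology X U2) = U2" using V2 openin_subset by auto
    have fW: "f ` W \<subseteq> U2" by (auto simp: W_def)
    have WX: "W \<subseteq> topspace X" by (auto simp: W_def)
    have "openin (Euclidean_space n) ((g \<circ> f) ` W)"
    proof (rule euclidean_patch_image_open[OF W])
      have "continuous_map (subtopology X W) (subtopology X U2) f"
        using f(1) fW by (auto simp: continuous_map_in_subtopology continuous_map_from_subtopology)
      moreover have "continuous_map (subtopology X U2) (Euclidean_space n) g"
        using homeomorphic_imp_continuous_map[OF g] by (simp add: continuous_map_in_subtopology)
      ultimately show "continuous_map (subtopology X W) (Euclidean_space n) (g \<circ> f)"
        by (rule continuous_map_compose)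
      show "inj_on (g \<circ> f) W"
        using homeomorphic_imp_injective_map[OF g] fW WX f(2) top2
        by (metis comp_inj_on inj_on_subset)
    qed
    moreover have "g ` f ` W \<subseteq> V2"
      using fW homeomorphic_imp_surjective_map[OF g] top2 by fastforce
    ultimately have "openin (subtopology (Euclidean_space n) V2) (g ` f ` W)"
      using V2(2) by (simp add: openin_open_subtopology image_comp)
    then have "openin (subtopology X U2) (f ` W)"
      using homeomorphic_map_openness[OF g, of "f ` W"] fW unfolding top2 by blast
    then have "openin X (f ` W)" using V2(1) openin_trans_full by blast
    moreover have "f p \<in> f ` W" using p U1 U2 pX by (auto simp: W_def)
    moreover have "f ` W \<subseteq> f ` U" by (auto simp: W_def)
    ultimately show "\<exists>T. openin X T \<and> f p \<in> T \<and> T \<subseteq> f ` U" by blast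
  qed
qed

lemma patch_connected_neighbourhood:
  assumes "euclidean_patch n X U" "p \<in> U"
  obtains C where "openin X C" "connectedin X C" "p \<in> C"
proof -
  obtain V where U: "openin X U" and V: "openin (Euclidean_space n) V"
    and hom: "subtopology X U homeomorphic_space subtopology (Euclidean_space n) V"
    using assms(1) by (auto simp: euclidean_patch_def)
  have "locally_connected_space (Euclidean_space n)"
    using locally_path_connected_Euclidean_space locally_path_connected_imp_locally_connected_space by blast
  then have "locally_connected_space (subtopology X U)"
    using V hom homeomorphic_locally_connected_space locally_connected_space_open_subset by blast
  moreover have "openin (subtopology X U) U" using U by (simp add: openin_open_subtopology)
  ultimately obtain C where "openin (subtopology X U) C" "connectedin (subtopology X U) C" "p \<in> C"
    using assms(2) unfolding locally_connected_space by blast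
  then show ?thesis using that U openin_trans_full connectedin_subtopology by metis
qed

text \<open>If the image were a proper subset, the iterated images of its complement would be infinitely
  many disjoint clopen sets; a compact space covered by connected open sets has only finitely many.\<close>
lemma compact_manifold_inj_surj:
  assumes mf: "manifold_without_boundary n X" and comp: "compact_space X"
    and f: "continuous_map X X f" "inj_on f (topspace X)"
  shows "f ` topspace X = topspace X"
proof (rule ccontr)
  let ?T = "topspace X"
  assume neq: "f ` ?T \<noteq> ?T"
  have om: "open_map X X f" by (rule manifold_inj_open_map[OF mf f])
  \<comment> \<open>Images of clopen sets are clopen: f is open by invariance of domain, and closed
    because X is compact and Hausdorff.\<close>
  have "kc_space X" using mf by (simp add: manifold_without_boundary_def Hausdorff_imp_kc_space)
  then have cm: "closed_map X X f" using comp f(1) continuous_imp_closed_map_gen by blast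
  have fim: "f ` ?T \<subseteq> ?T" using f(1) by (auto simp: continuous_map_def)
  define Z where "Z k = (f ^^ k) ` (?T - f ` ?T)" for k
  have Z0: "Z 0 = ?T - f ` ?T" and ZS: "Z (Suc k) = f ` Z k" for k
    by (auto simp: Z_def image_comp)
  have "openin X (f ` ?T)" "closedin X (f ` ?T)"
    using om cm by (auto simp: open_map_def closed_map_def)
  then have clopen: "openin X (Z k) \<and> closedin X (Z k)" for k
    using om cm by (induction k) (auto simp: Z0 ZS open_map_def closed_map_def)
  then have ZT: "Z k \<subseteq> ?T" for k using openin_subset by blast
  have ne: "Z k \<noteq> {}" for k using neq fim by (auto simp: Z_def)
  \<comment> \<open>\<open>Z 0\<close> misses the range of f; injectivity carries this disjointness
    along the iterates.\<close>
  have disj0: "Z 0 \<inter> Z (Suc k) = {}" for k using ZT[of k] by (auto simp: Z0 ZS)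
  have "Z i \<inter> Z (Suc (i + k)) = {}" for i k
  proof (induction i)
    case 0
    then show ?case using disj0 by simp
  next
    case (Suc i)
    have "f ` Z i \<inter> f ` Z (Suc (i + k)) = f ` (Z i \<inter> Z (Suc (i + k)))"
      using inj_on_image_Int[OF f(2) ZT ZT] by simp
    then show ?case using Suc by (simp add: ZS)
  qed
  then have disj_less: "Z i \<inter> Z j = {}" if "i < j" for i j
    using less_imp_Suc_add[OF that] by auto
  then have disj: "Z i \<inter> Z j = {}" if "i \<noteq> j" for i j
    using that by (metis Int_commute nat_neq_iff)
  let ?C = "{C. openin X C \<and> connectedin X C}"
  have "?T \<subseteq> \<Union> ?C"
  proof
    fix p assume "p \<in> ?T"
    then obtain U where "p \<in> U" "euclidean_patch n X U" by (rule manifold_patch[OF mf])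
    then obtain C where "openin X C" "connectedin X C" "p \<in> C"
      using patch_connected_neighbourhood by metis
    then show "p \<in> \<Union> ?C" by blast
  qed
  then obtain F where F: "finite F" "F \<subseteq> ?C" "?T \<subseteq> \<Union> F"
    using comp unfolding compact_space_alt by (metis (no_types, lifting) mem_Collect_eq)
  have "\<exists>C\<in>F. C \<noteq> {} \<and> C \<subseteq> Z k" for k
  proof -
    obtain z where z: "z \<in> Z k" using ne by blast
    then obtain C where C: "C \<in> F" "z \<in> C" using F(3) ZT by blast
    then have "C \<subseteq> Z k"
      using connectedin_clopen_cases[of X C "Z k"] clopen F(2) z by (auto simp: disjnt_iff)
    then show ?thesis using C by blast
  qed
  then obtain c where c: "\<And>k. c k \<in> F" "\<And>k. c k \<noteq> {}" "\<And>k. c k \<subseteq> Z k" by metis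
  have "inj c"
  proof (rule injI, rule ccontr)
    fix i j assume ij: "c i = c j" "i \<noteq> j"
    then have "c i \<subseteq> Z i \<inter> Z j" using c(3) by (metis le_inf_iff)
    then show False using disj[OF ij(2)] c(2) by blast
  qed
  then have "infinite (range c)" using finite_imageD infinite_UNIV_nat by blast
  then show False using F(1) c(1) by (meson finite_subset image_subsetI)
qed

section \<open>Subsets of Euclidean space with dense interior\<close>

text \<open>U corresponds to a trace Q \<inter> S with Q open. By density Q meets the interior of S,
  and that intersection is open in the Euclidean space as well as in S.\<close>

lemma dense_interior_patch:
  assumes S: "S \<subseteq> Euclidean_space n closure_of (Euclidean_space n interior_of S)"
    and hom: "X homeomorphic_space subtopology (Euclidean_space n) S"
    and U: "openin X U" "U \<noteq> {}"
  obtains W where "W \<subseteq> U" "W \<noteq> {}" "euclidean_patch n X W"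
proof -
  let ?E = "Euclidean_space n"
  obtain f g where fg: "homeomorphic_maps X (subtopology ?E S) f g"
    using hom by (auto simp: homeomorphic_space_def)
  then have f: "homeomorphic_map X (subtopology ?E S) f" and g: "homeomorphic_map (subtopology ?E S) X g"
    and gf: "\<And>x. x \<in> topspace X \<Longrightarrow> g (f x) = x"
    by (auto simp: homeomorphic_maps_map)
  have UX: "U \<subseteq> topspace X" using U openin_subset by blast
  have "openin (subtopology ?E S) (f ` U)" using homeomorphic_map_openness[OF f UX] U by simp
  then obtain Q where Q: "openin ?E Q" "f ` U = Q \<inter> S" by (auto simp: openin_subtopology)
  define V where "V = Q \<inter> ?E interior_of S"
  have V: "openin ?E V" by (simp add: V_def Q openin_Int)
  have VS: "V \<subseteq> f ` U" using Q interior_of_subset[of ?E S] by (auto simp: V_def)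
  have "Q \<inter> ?E closure_of (?E interior_of S) \<noteq> {}" using S Q U by blast
  then have Vne: "V \<noteq> {}" using openin_Int_closure_of_eq_empty[OF Q(1)] by (simp add: V_def)
  have VE: "V \<subseteq> topspace (subtopology ?E S)" using VS homeomorphic_imp_surjective_map[OF f] UX by blast
  define W where "W = g ` V"
  have "openin (subtopology ?E S) V"
    using V VE by (metis inf.absorb_iff2 inf_commute openin_subtopology topspace_subtopology le_inf_iff)
  then have W: "openin X W" using homeomorphic_map_openness[OF g VE] by (simp add: W_def)
  have "W \<subseteq> U"
  proof
    fix w assume "w \<in> W"
    then obtain u where "u \<in> U" "w = g (f u)" using VS by (auto simp: W_def)
    then show "w \<in> U" using gf UX by auto
  qed
  moreover have "homeomorphic_map (subtopology (subtopology ?E S) V) (subtopology X W) g"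
  proof (rule homeomorphic_map_subtopologies[OF g])
    show "g ` (topspace (subtopology ?E S) \<inter> V) = topspace X \<inter> W"
      using VE openin_subset[OF W] by (auto simp: W_def)
  qed
  moreover have "subtopology (subtopology ?E S) V = subtopology ?E V"
    using VE by (simp add: subtopology_subtopology Int_absorb1)
  ultimately have "subtopology X W homeomorphic_space subtopology ?E V"
    using homeomorphic_map_imp_homeomorphic_space homeomorphic_space_sym by metis
  then have "euclidean_patch n X W" using W V by (auto simp: euclidean_patch_def)
  then show ?thesis using that \<open>W \<subseteq> U\<close> Vne by (simp add: W_def)
qed

section \<open>The half-space has dense interior, so manifolds with boundary have dense
  patches\<close>

lemma continuous_map_Euclidean_projection:
  "continuous_map (Euclidean_space n) euclideanreal (\<lambda>x. x i)"
  unfolding Euclidean_space_def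
  by (rule continuous_map_from_subtopology[OF continuous_map_product_projection]) simp

lemma half_space_dense_interior:
  "topspace (half_space n) \<subseteq> Euclidean_space n closure_of (Euclidean_space n interior_of topspace (half_space n))"
proof (cases "n = 0")
  case True
  then have "topspace (half_space n) = topspace (Euclidean_space n)"
    by (auto simp: half_space_def topspace_Euclidean_space)
  then show ?thesis by simp
next
  case False
  let ?E = "Euclidean_space n"
  let ?P = "{y \<in> topspace ?E. y (n - 1) \<in> {0<..}}"
  have "openin ?E ?P"
    by (rule openin_continuous_map_preimage[OF continuous_map_Euclidean_projection]) simp
  then have P: "?P \<subseteq> ?E interior_of topspace (half_space n)"
    by (intro interior_of_maximal) (auto simp: half_space_def)
  show ?thesis
  proof
    fix x assume "x \<in> topspace (half_space n)"
    then have x: "x \<in> topspace ?E" "0 \<le> x (n - 1)" by (auto simp: half_space_def)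
    have "\<exists>y. y \<in> ?P \<and> y \<in> T" if T: "x \<in> T" "openin ?E T" for T
    proof -
      \<comment> \<open>Moves the last coordinate by t. All coordinates from n on are set to 0, so
        every c t is a point of the Euclidean space; a small t > 0 stays in T and enters the open
        half.\<close>
      define c where "c t = (\<lambda>i. if i < n then (if i = n - 1 then x i + t else x i) else 0)" for t :: real
      have "continuous_map euclideanreal ?E c"
        unfolding c_def continuous_map_componentwise_Euclidean_space
        by (auto intro!: continuous_intros)
      then have "open {t. c t \<in> T}"
        using openin_continuous_map_preimage[of euclideanreal ?E c T] T(2) by simp
      moreover have "c 0 = x" using x(1) by (auto simp: c_def topspace_Euclidean_space)
      ultimately obtain e where e: "e > 0" "ball 0 e \<subseteq> {t. c t \<in> T}"
        using T(1) open_contains_ball by (metis mem_Collect_eq)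
      have "c (e / 2) \<in> T" using e by (auto simp: subset_iff)
      moreover have "c (e / 2) \<in> ?P"
        using x False e(1) by (auto simp: c_def topspace_Euclidean_space)
      ultimately show ?thesis by blast
    qed
    then show "x \<in> ?E closure_of (?E interior_of topspace (half_space n))"
      using x(1) P unfolding in_closure_of by blast
  qed
qed

lemma manifold_with_boundary_patch:
  assumes mf: "manifold_with_boundary n X" and U: "openin X U" "U \<noteq> {}"
  obtains W where "W \<subseteq> U" "W \<noteq> {}" "euclidean_patch n X W"
proof -
  let ?E = "Euclidean_space n" and ?H = "topspace (half_space n)"
  obtain p where p: "p \<in> U" using U by blast
  then have "p \<in> topspace X" using U openin_subset by blast
  then obtain U1 V where U1: "openin X U1" "p \<in> U1" and V: "openin (half_space n) V"
    and hom: "subtopology X U1 homeomorphic_space subtopology (half_space n) V"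
    using mf unfolding manifold_with_boundary_def locally_homeomorphic_to_def by metis
  have half: "half_space n = subtopology ?E ?H"
    by (simp add: half_space_def subtopology_restrict)
  obtain Q where Q: "openin ?E Q" "V = Q \<inter> ?H"
    using V by (subst (asm) half) (auto simp: openin_subtopology)
  have "subtopology (half_space n) V = subtopology ?E V"
    using Q by (subst half) (simp add: subtopology_subtopology inf_commute Int_left_commute)
  then have hom': "subtopology X U1 homeomorphic_space subtopology ?E V" using hom by simp
  \<comment> \<open>A chart domain at the boundary is open only in the half-space, but as the trace
    of an open set Q it inherits the dense interior.\<close>
  have "V \<subseteq> ?E closure_of (Q \<inter> ?E interior_of ?H)"
    using Q half_space_dense_interior openin_Int_closure_of_subset[OF Q(1)] by blast
  also have "\<dots> \<subseteq> ?E closure_of (?E interior_of V)"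
    using Q by (intro closure_of_mono) (simp add: interior_of_Int interior_of_openin)
  finally have dense: "V \<subseteq> ?E closure_of (?E interior_of V)" .
  have "openin (subtopology X U1) (U \<inter> U1)"
    using U U1 by (simp add: openin_open_subtopology openin_Int)
  then obtain W where W: "W \<subseteq> U \<inter> U1" "W \<noteq> {}" "euclidean_patch n (subtopology X U1) W"
    using dense_interior_patch[OF dense hom'] p U1(2) by blast
  show ?thesis
    using that[of W] W(1,2) euclidean_patch_open_subtopology[OF W(3) U1(1)] by blast
qed

section \<open>Rational points, and the criterion behind cases (ii) and (iii)\<close>

lemma open_has_rational_point:
  assumes U: "openin (Euclidean_space n) U" "U \<noteq> {}"
  obtains y where "y \<in> U" "\<And>i. y i \<in> \<rat>"
proof -
  obtain x where x: "x \<in> U" using U by blast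
  obtain T where T: "openin (powertop_real UNIV) T" "U = T \<inter> {x. \<forall>i\<ge>n. x i = 0}"
    using U(1) by (auto simp: Euclidean_space_def openin_subtopology)
  then obtain B where B: "x \<in> (\<Pi>\<^sub>E i\<in>UNIV. B i)" "\<And>i. open (B i)" "(\<Pi>\<^sub>E i\<in>UNIV. B i) \<subseteq> T"
    using product_topology_open_contains_basis[OF T(1), of x] x by auto
  have "\<exists>r\<in>\<rat>. r \<in> B i" for i
  proof -
    have "x i \<in> B i" using B(1) by auto
    then obtain e where e: "e > 0" "ball (x i) e \<subseteq> B i" using B(2) open_contains_ball by blast
    then obtain r where "r \<in> \<rat>" "x i < r" "r < x i + e"
      using Rats_dense_in_real[of "x i" "x i + e"] by auto
    then have "r \<in> ball (x i) e" by (simp add: dist_real_def)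
    then show ?thesis using e(2) \<open>r \<in> \<rat>\<close> by blast
  qed
  then obtain r where r: "\<And>i. r i \<in> \<rat>" "\<And>i. r i \<in> B i" by metis
  define y where "y i = (if i < n then r i else 0)" for i
  have "y i \<in> B i" for i
  proof (cases "i < n")
    case True
    then show ?thesis using r(2) by (simp add: y_def)
  next
    case False
    then have "x i = 0" using x T(2) by simp
    moreover have "x i \<in> B i" using B(1) by auto
    ultimately show ?thesis using False by (simp add: y_def)
  qed
  then have "y \<in> (\<Pi>\<^sub>E i\<in>UNIV. B i)" by (simp add: PiE_iff)
  then have "y \<in> T" using B(3) by (rule subsetD[rotated])
  then have "y \<in> U" using T(2) by (simp add: y_def)
  moreover have "y i \<in> \<rat>" for i using r(1) by (simp add: y_def)
  ultimately show ?thesis using that by blast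
qed

text \<open>Semisimplicity makes the support of a nonzero a nonempty, so it contains a patch.
  Evaluation at the n generators embeds this patch as an open set of the same dimension n, and a
  rational point of it is a character with rational values on generators that does not vanish at
  a.\<close>

lemma (in mv_algebra) hopfian_if_patches_dense:
  assumes ss: "semisimple A" and gen: "has_generating_set_of_size A n"
    and dense: "\<And>U. \<lbrakk>openin (max_spectrum A) U; U \<noteq> {}\<rbrakk>
      \<Longrightarrow> \<exists>W\<subseteq>U. W \<noteq> {} \<and> euclidean_patch n (max_spectrum A) W"
  shows "hopfian A"
proof -
  obtain S where S: "S \<subseteq> carrier A" "finite S" "card S = n" "mv_generate A S = carrier A"
    using gen by (auto simp: has_generating_set_of_size_def)
  obtain g where g: "bij_betw g {0..<n} S" using ex_bij_betw_nat_finite[OF S(2)] S(3) by blast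
  have gS: "g i \<in> carrier A" if "i < n" for i using that g S(1) by (auto simp: bij_betw_def)
  define e where "e M = (\<lambda>i. if i < n then char_of M (g i) else 0)" for M
  have cont: "continuous_map (max_spectrum A) (Euclidean_space n) e"
    unfolding e_def continuous_map_componentwise_Euclidean_space
    using continuous_map_char_of gS by blast
  have inj: "inj_on e (max_ideals A)"
  proof (rule inj_onI)
    fix M N assume MN: "M \<in> max_ideals A" "N \<in> max_ideals A" "e M = e N"
    have "char_of M s = char_of N s" if s: "s \<in> S" for s
    proof -
      obtain i where "i < n" "s = g i" using s g by (auto simp: bij_betw_def)
      then show ?thesis using fun_cong[OF MN(3), of i] by (simp add: e_def)
    qed
    then have "char_of M a = char_of N a" if "a \<in> carrier A" for a
      using characters_agree[OF S(1,4) char_of(1)[OF MN(1)] char_of(1)[OF MN(2)]] that by blast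
    then have "ker (char_of M) = ker (char_of N)" by (auto simp: in_ker_iff)
    then show "M = N" using char_of(2) MN by metis
  qed
  show ?thesis
  proof (rule hopfian_if_residually_finite[OF S(1,2,4)])
    fix a assume a: "a \<in> carrier A" "a \<noteq> \<zero>"
    then have "supp a \<noteq> {}" using ss by (auto simp: semisimple_def supp_def)
    then obtain W where W: "W \<subseteq> supp a" "W \<noteq> {}" "euclidean_patch n (max_spectrum A) W"
      using dense openin_supp a by meson
    have WX: "W \<subseteq> max_ideals A" using W by (auto simp: supp_def)
    have "openin (Euclidean_space n) (e ` W)"
      using W(3) cont inj WX
      by (intro euclidean_patch_image_open continuous_map_from_subtopology) (auto intro: inj_on_subset)
    then obtain y where y: "y \<in> e ` W" "\<And>i. y i \<in> \<rat>" using open_has_rational_point W(2) by blast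
    then obtain M where M: "M \<in> W" "y = e M" by blast
    then have MX: "M \<in> max_ideals A" using WX by blast
    have "char_of M s \<in> \<rat>" if s: "s \<in> S" for s
    proof -
      obtain i where "i < n" "s = g i" using s g by (auto simp: bij_betw_def)
      then show ?thesis using y(2)[of i] M by (simp add: e_def)
    qed
    moreover have "0 < char_of M a" using char_of_pos_iff[OF MX a(1)] M W by blast
    ultimately show "\<exists>\<phi>. character \<phi> \<and> \<phi> a \<noteq> 0 \<and> (\<forall>s\<in>S. \<phi> s \<in> \<rat>)"
      using char_of(1)[OF MX] by (intro exI[of _ "char_of M"]) auto
  qed
qed

theorem theorem4p3:
  fixes A :: "('a, 'm) mv_algebra_scheme" and n :: nat
  assumes "mv_algebra A" and "semisimple A"
  shows "(manifold_without_boundary n (max_spectrum A) \<longrightarrow> hopfian A) \<and>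
    (manifold_with_boundary n (max_spectrum A) \<and> has_generating_set_of_size A n \<longrightarrow> hopfian A) \<and>
    (has_generating_set_of_size A n \<and>
      (\<exists>X \<subseteq> unit_cube n.
        X = Euclidean_space n closure_of (Euclidean_space n interior_of X) \<and>
        max_spectrum A homeomorphic_space subtopology (Euclidean_space n) X)
      \<longrightarrow> hopfian A)"
proof -
  interpret mv_algebra A by fact
  note ss = \<open>semisimple A\<close>
  have "hopfian A" if "manifold_without_boundary n (max_spectrum A)"
  proof (rule hopfian_if_pullbacks_surj[OF ss])
    \<comment> \<open>The pullback along h is an injective continuous self-map of a compact
      manifold, hence onto.\<close>
    fix h assume "h \<in> mv_hom A A" "h ` carrier A = carrier A"
    then show "pullback h ` max_ideals A = max_ideals A"
      using compact_manifold_inj_surj[OF that compact_max_spectrum continuous_map_pullback]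
        inj_on_pullback by simp
  qed
  moreover have "hopfian A"
    if mf: "manifold_with_boundary n (max_spectrum A)" and gen: "has_generating_set_of_size A n"
    by (rule hopfian_if_patches_dense[OF ss gen]) (metis manifold_with_boundary_patch[OF mf])
  moreover have "hopfian A"
    if gen: "has_generating_set_of_size A n"
      and X: "X = Euclidean_space n closure_of (Euclidean_space n interior_of X)"
      and hom: "max_spectrum A homeomorphic_space subtopology (Euclidean_space n) X" for X
    by (rule hopfian_if_patches_dense[OF ss gen]) (metis dense_interior_patch[OF _ hom] X order_refl)
  ultimately show ?thesis by blast
qed

end
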